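(* Let $p,q$ be positive integers and $\varphi:[0,+\infty)\to(0,+\infty)$ a non-decreasing unbounded function. Let $f_1,f_2$ be meromorphic functions and $g_1,g_2$ entire functions, and suppose $g_1\pm g_2$ has the Property (A). Then $$\rho_{g_1\pm g_2}(f_1\pm f_2)\le \max\big[\min\{\rho_{g_1}(f_1),\rho_{g_2}(f_1)\},\ \min\{\rho_{g_1}(f_2),\rho_{g_2}(f_2)\}\big]$$ when the following two conditions hold: (i) $\rho_{g_i}(f_1)<\rho_{g_j}(f_1)$ and $f_1$ is of regular relative $(p,q)$-$\varphi$ growth with respect to $g_j$, for some $i,j\in\{1,2\}$, $i\ne j$; (ii) $\rho_{g_i}(f_2)<\rho_{g_j}(f_2)$ and $f_2$ is of regular relative $(p,q)$-$\varphi$ growth with respect to $g_j$, for some $i,j\in\{1,2\}$, $i\ne j$. Equality holds when $\rho_{g_1}(f_i)<\rho_{g_1}(f_j)$ and $\rho_{g_2}(f_i)<\rho_{g_2}(f_j)$ hold simultaneously for some $i,j\in\{1,2\}$, $i\ne j$.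
   Context: Meromorphic and entire functions are on the whole plane $\mathbb{C}$. $M_g(r)=\max_{|z|=r}|g(z)|$, and $T_f(r)$ is the Nevanlinna characteristic function of $f$. For a non-constant entire $g$, $T_g$ is strictly increasing and continuous, with inverse $T_g^{-1}:(|g(0)|,\infty)\to(0,\infty)$, $\lim_{s\to\infty}T_g^{-1}(s)=\infty$. Iterated logarithms: $\log^{[0]}x=x$, $\log^{[k]}x=\log(\log^{[k-1]}x)$ for $k\ge1$. For fixed positive integers $p,q$ and fixed $\varphi$, the relative $(p,q)$-$\varphi$ order and lower order of a meromorphic $f$ with respect to an entire $g$ (full notation $\rho_g^{(p,q)}(f,\varphi)$, $\lambda_g^{(p,q)}(f,\varphi)$, abbreviated $\rho_g(f)$, $\lambda_g(f)$) are the $\limsup$ and the $\liminf$, respectively, as $r\to\infty$ of $\dfrac{\log^{[p]}T_g^{-1}(T_f(r))}{\log^{[q]}\varphi(r)}$. $f$ is of regular relative $(p,q)$-$\varphi$ growth with respect to $g$ if $\rho_g(f)=\lambda_g(f)$. A non-constant entire $g$ has the Property (A) if for every $\sigma>1$ and all sufficiently large $r$, $[M_g(r)]^2\le M_g(r^\sigma)$. Standing assumption: all growth indicators that occur are nonzero and finite. The symbol $\pm$ means either choice of sign, the same choice at every occurrence of the same expression (the sign in $f_1\pm f_2$ and the sign in $g_1\pm g_2$ need not coincide). *)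

theory Defs
  imports "HOL-Complex_Analysis.Complex_Analysis"
begin

definition max_modulus :: "(complex \<Rightarrow> complex) \<Rightarrow> real \<Rightarrow> real" where
  "max_modulus g r = (SUP z\<in>sphere 0 r. norm (g z))"

text \<open>
  Nevanlinna theory. Functions are total, and a meromorphic function may take arbitrary values
  at its poles and on a discrete set. This does not affect the definitions below: poles and
  their orders depend only on punctured neighbourhoods, and the proximity function is an
  integral.
\<close>

definition pole_count :: "(complex \<Rightarrow> complex) \<Rightarrow> real \<Rightarrow> real" where
  "pole_count f t = (\<Sum>z | norm z \<le> t \<and> is_pole f z. of_int (- zorder f z))"

definition counting_fun :: "(complex \<Rightarrow> complex) \<Rightarrow> real \<Rightarrow> real" where
  "counting_fun f r =
     integral {0..r} (\<lambda>t. (pole_count f t - pole_count f 0) / t) + pole_count f 0 * ln r"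

text \<open>Here \<open>ln (max 1 x)\<close> is the positive part of the logarithm, with value 0 at \<open>x = 0\<close>.\<close>

definition proximity_fun :: "(complex \<Rightarrow> complex) \<Rightarrow> real \<Rightarrow> real" where
  "proximity_fun f r =
     1 / (2 * pi) * integral {0..2 * pi} (\<lambda>\<theta>. ln (max 1 (norm (f (of_real r * cis \<theta>)))))"

definition nevanlinna_char :: "(complex \<Rightarrow> complex) \<Rightarrow> real \<Rightarrow> real" where
  "nevanlinna_char f r = proximity_fun f r + counting_fun f r"

text \<open>
  For non-constant entire \<open>g\<close>, every \<open>s > norm (g 0)\<close> has exactly one preimage \<open>r > 0\<close> under
  the characteristic of \<open>g\<close>, so the following is the inverse function there. (If
  \<open>norm (g 0) < 1\<close>, the characteristic vanishes near 0, so it is not injective on all of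
  \<open>{0<..}\<close>.)
\<close>

definition nevanlinna_char_inv :: "(complex \<Rightarrow> complex) \<Rightarrow> real \<Rightarrow> real" where
  "nevanlinna_char_inv g = the_inv_into {0<..} (nevanlinna_char g)"

definition growth_ratio ::
  "nat \<Rightarrow> nat \<Rightarrow> (real \<Rightarrow> real) \<Rightarrow> (complex \<Rightarrow> complex) \<Rightarrow> (complex \<Rightarrow> complex) \<Rightarrow> real \<Rightarrow> real" where
  "growth_ratio p q \<phi> g f r =
     (ln ^^ p) (nevanlinna_char_inv g (nevanlinna_char f r)) / (ln ^^ q) (\<phi> r)"

definition rel_order ::
  "nat \<Rightarrow> nat \<Rightarrow> (real \<Rightarrow> real) \<Rightarrow> (complex \<Rightarrow> complex) \<Rightarrow> (complex \<Rightarrow> complex) \<Rightarrow> ereal" where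
  "rel_order p q \<phi> g f = Limsup at_top (\<lambda>r. ereal (growth_ratio p q \<phi> g f r))"

definition rel_lower_order ::
  "nat \<Rightarrow> nat \<Rightarrow> (real \<Rightarrow> real) \<Rightarrow> (complex \<Rightarrow> complex) \<Rightarrow> (complex \<Rightarrow> complex) \<Rightarrow> ereal" where
  "rel_lower_order p q \<phi> g f = Liminf at_top (\<lambda>r. ereal (growth_ratio p q \<phi> g f r))"

definition regular_rel_growth ::
  "nat \<Rightarrow> nat \<Rightarrow> (real \<Rightarrow> real) \<Rightarrow> (complex \<Rightarrow> complex) \<Rightarrow> (complex \<Rightarrow> complex) \<Rightarrow> bool" where
  "regular_rel_growth p q \<phi> g f \<longleftrightarrow> rel_order p q \<phi> g f = rel_lower_order p q \<phi> g f"

definition nonzero_finite :: "ereal \<Rightarrow> bool" where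
  "nonzero_finite x \<longleftrightarrow> x \<noteq> 0 \<and> \<bar>x\<bar> \<noteq> \<infinity>"

definition nonconst_entire :: "(complex \<Rightarrow> complex) \<Rightarrow> bool" where
  "nonconst_entire g \<longleftrightarrow> g holomorphic_on UNIV \<and> \<not> g constant_on UNIV"

definition property_A :: "(complex \<Rightarrow> complex) \<Rightarrow> bool" where
  "property_A g \<longleftrightarrow> nonconst_entire g \<and>
     (\<forall>\<sigma>>1. \<forall>\<^sub>F r in at_top. (max_modulus g r)\<^sup>2 \<le> max_modulus g (r powr \<sigma>))"

end

theory Submission
  imports Defs
begin

text \<open>
  Write \<open>L = (ln ^^ q) \<circ> \<phi>\<close>, \<open>E = exp ^^ p\<close> and let T be the characteristic. For large r, a bound
  \<open>growth_ratio \<le> c\<close> for f with respect to g says \<open>T f r \<le> T g (E (c * L r))\<close>, so all bounds can be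
  compared at the same r. Two facts on entire functions drive the argument. Since \<open>T g (exp x)\<close> is
  convex in x, \<open>T g R \<le> \<kappa> * T g (R powr \<sigma>)\<close> with \<open>\<kappa> < 1\<close> whenever \<open>\<sigma> > 1\<close>; and Property (A)
  together with a Harnack inequality gives \<open>K * T g R \<le> T g (R powr \<sigma>)\<close> for every K.
  If f has smaller order with respect to \<open>ga\<close> than its lower order with respect to \<open>gb\<close>, then at
  \<open>R = E (c * L r)\<close>, c slightly above the smaller order, \<open>T gb R\<close> is at most a fraction of
  \<open>T f r \<le> T ga R\<close>. So \<open>T ga R\<close> is bounded by a multiple of the characteristic of \<open>ga \<plusminus> gb\<close> at R,
  and Property (A) absorbs the factor. Equality comes from the same comparison in the other direction.
\<close>

section \<open>Circle means and the maximum modulus principle\<close>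

text \<open>Property (A) is at hand only for \<open>G = ga \<plusminus> gb\<close>, so a constant
  factor can be absorbed for G but not for \<open>ga\<close> or \<open>gb\<close> alone. For these
  the sole gain is the factor \<kappa> < 1 from convexity, possibly close to 1. It is enough: in
  \<open>T f \<le> T G + \<kappa> * T f + ln 2\<close> the middle term moves to the left, and the
  resulting constant \<open>2 / (1 - \<kappa>)\<close> stands in front of T G, where Property (A)
  removes it. The smaller order, a limsup, bounds T f from above for all large r. The bound of T f
  from below through \<open>gb\<close> must hold for all large r too, so it needs a lower order,
  which regular growth supplies. For equality one lower bound may hold merely for arbitrarily large
  r, since a limsup is estimated from below. Nonzero orders exclude bounded characteristics: a
  constant T f would make the ratio tend to 0. As \<open>integral\<close> has the default value 0 on
  non-integrable functions, integrability on circles through poles is proved before T is shown to be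
  subadditive up to ln 2.\<close>

definition circle_mean :: "(complex \<Rightarrow> real) \<Rightarrow> real \<Rightarrow> real" where
  "circle_mean u r = 1 / (2 * pi) * integral {0..2 * pi} (\<lambda>\<theta>. u (of_real r * cis \<theta>))"

text \<open>An equally spaced Riemann sum for the circle mean. It starts at z itself, so as a
  function of z it is an average of rotates of u.\<close>

definition root_mean :: "nat \<Rightarrow> (complex \<Rightarrow> real) \<Rightarrow> complex \<Rightarrow> real" where
  "root_mean N u z = (\<Sum>k<N. u (z * cis (2 * pi * real k / real N))) / N"

definition log_plus :: "real \<Rightarrow> real" where
  "log_plus x = ln (max 1 x)"

lemma log_plus_nonneg [simp]: "0 \<le> log_plus x"
  by (simp add: log_plus_def)

lemma log_plus_mono: "x \<le> y \<Longrightarrow> log_plus x \<le> log_plus y"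
  by (simp add: log_plus_def)

lemma exp_log_plus: "exp (log_plus x) = max 1 x"
  by (simp add: log_plus_def)

lemma continuous_on_log_plus [continuous_intros]:
  "continuous_on A f \<Longrightarrow> continuous_on A (\<lambda>x. log_plus (f x))"
  unfolding log_plus_def by (intro continuous_intros) (auto simp: max_def)

text \<open>The range \<open>\<bar>a\<bar> \<le> c\<close> avoids reduction modulo the period: a
  single shift by c makes a negative a nonnegative. It covers both uses, the argument of a point and
  the starting value of a lifted angle.\<close>

lemma integral_periodic:
  fixes w :: "real \<Rightarrow> real"
  assumes w: "continuous_on UNIV w" and per: "\<And>x. w (x + c) = w x" and a: "\<bar>a\<bar> \<le> c"
  shows "integral {a..a + c} w = integral {0..c} w"
proof -
  have nonneg: "integral {a..a + c} w = integral {0..c} w" if a: "0 \<le> a" "a \<le> c" for a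
  proof -
    have int: "w integrable_on {x..y}" for x y
      by (intro integrable_continuous_real continuous_on_subset[OF w]) auto
    have "integral {a..a + c} w = integral {a..c} w + integral {c..a + c} w"
      using a by (intro Henstock_Kurzweil_Integration.integral_combine[symmetric] int) auto
    also have "integral {c..a + c} w = integral {0..a} w"
    proof -
      have "integral {0 + c..a + c} w = integral {0..a} (w \<circ> (\<lambda>x. x + c))"
        by (intro integral_shift[symmetric] continuous_on_subset[OF w]) auto
      then show ?thesis
        by (simp add: o_def per)
    qed
    also have "integral {a..c} w + integral {0..a} w = integral {0..c} w"
      using a by (subst add.commute, intro Henstock_Kurzweil_Integration.integral_combine int) auto
    finally show ?thesis .
  qed
  show ?thesis
  proof (cases "a \<ge> 0")
    case False
    have "integral {a..a + c} w = integral {a..a + c} (w \<circ> (\<lambda>x. x + c))"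
      by (simp add: o_def per)
    also have "\<dots> = integral {a + c..a + c + c} w"
      by (intro integral_shift continuous_on_subset[OF w]) auto
    also have "\<dots> = integral {0..c} w"
      using False a by (intro nonneg) auto
    finally show ?thesis .
  qed (use a nonneg in auto)
qed

lemma riemann_sum_error:
  fixes w :: "real \<Rightarrow> real"
  assumes w: "continuous_on UNIV w" and h: "0 \<le> h"
    and osc: "\<And>x y. \<bar>x - y\<bar> \<le> h \<Longrightarrow> \<bar>w x - w y\<bar> \<le> e"
  shows "\<bar>integral {a..a + real n * h} w - h * (\<Sum>k<n. w (a + real k * h))\<bar> \<le> real n * h * e"
proof (induction n)
  case (Suc n)
  let ?m = "a + real n * h"
  have int: "w integrable_on {x..y}" for x y
    by (intro integrable_continuous_real continuous_on_subset[OF w]) auto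
  have "integral {a..a + real (Suc n) * h} w = integral {a..?m} w + integral {?m..?m + h} w"
    using h by (subst Henstock_Kurzweil_Integration.integral_combine[symmetric, OF _ _ int, where c = ?m])
      (auto simp: algebra_simps)
  moreover have "\<bar>integral {?m..?m + h} w - h * w ?m\<bar> \<le> h * e"
  proof -
    have "integral {?m..?m + h} w - h * w ?m = integral {?m..?m + h} (\<lambda>x. w x - w ?m)"
      using h by (subst integral_diff[OF int]) auto
    also have "\<bar>\<dots>\<bar> \<le> e * (?m + h - ?m)"
      using h osc integral_bound[of ?m "?m + h" "\<lambda>x. w x - w ?m" e]
      by (simp add: continuous_on_diff continuous_on_subset[OF w])
    finally show ?thesis by (simp add: mult.commute)
  qed
  ultimately show ?case
    using Suc.IH by (simp add: algebra_simps)
qed auto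

text \<open>The same N serves for every z on the circle: a Riemann sum started at the angle of z
  approximates an integral over a full period, which does not depend on the start, and uniform
  continuity bounds the error.\<close>

lemma root_mean_approx:
  assumes u: "continuous_on (sphere 0 r) u" and r: "0 \<le> r" and e: "0 < e"
  shows "\<forall>\<^sub>F N in sequentially. \<forall>z\<in>sphere 0 r. \<bar>root_mean N u z - circle_mean u r\<bar> \<le> e"
proof -
  define w where "w \<theta> = u (of_real r * cis \<theta>)" for \<theta>
  have w: "continuous_on UNIV w" unfolding w_def
    by (rule continuous_on_compose2[OF u]) (use r in \<open>auto intro!: continuous_intros simp: norm_mult\<close>)
  have per: "w (x + 2 * pi) = w x" for x
    by (simp add: w_def cis_mult[symmetric])
  obtain d where d: "d > 0" "\<And>x y. x \<in> sphere 0 r \<Longrightarrow> y \<in> sphere 0 r \<Longrightarrow> dist x y < d \<Longrightarrow> dist (u x) (u y) < e"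
    using compact_uniformly_continuous[OF u] e unfolding uniformly_continuous_on_def
    by (metis compact_sphere)
  have cis_lip: "norm (cis x - cis y) \<le> \<bar>x - y\<bar>" for x y :: real
  proof -
    have "norm (cis x - cis y) = norm (cis y) * norm (cis (x - y) - 1)"
      by (subst norm_mult[symmetric]) (simp add: algebra_simps cis_mult)
    also have "\<dots> = 2 * \<bar>sin ((x - y) / 2)\<bar>"
      using dist_exp_i_1[of "x - y"] by (simp add: cis_conv_exp)
    also have "\<dots> \<le> \<bar>x - y\<bar>"
      using abs_sin_x_le_abs_x[of "(x - y) / 2"] by simp
    finally show ?thesis .
  qed
  have osc: "\<bar>w x - w y\<bar> \<le> e" if "\<bar>x - y\<bar> * r < d" for x y
  proof -
    have "dist (of_real r * cis x) (of_real r * cis y) = r * norm (cis x - cis y)"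
      using r by (simp add: dist_norm norm_mult flip: right_diff_distrib)
    also have "\<dots> \<le> r * \<bar>x - y\<bar>"
      using cis_lip r by (intro mult_left_mono)
    also have "\<dots> < d" using that by (simp add: mult.commute)
    finally show ?thesis
      using d(2)[of "of_real r * cis x" "of_real r * cis y"] r
      by (simp add: w_def norm_mult dist_real_def)
  qed
  have "(\<lambda>N. 2 * pi / real N * r) \<longlonglongrightarrow> 0"
    by real_asymp
  then have "\<forall>\<^sub>F N in sequentially. 2 * pi / real N * r < d"
    using d(1) by (rule order_tendstoD)
  then show ?thesis
    using eventually_gt_at_top[of 0]
  proof eventually_elim
    case (elim N)
    define h where "h = 2 * pi / real N"
    have h: "h \<ge> 0" "real N * h = 2 * pi"
      using elim by (auto simp: h_def)
    have osch: "\<bar>w x - w y\<bar> \<le> e" if "\<bar>x - y\<bar> \<le> h" for x y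
    proof (rule osc)
      have "\<bar>x - y\<bar> * r \<le> h * r" using that r by (intro mult_right_mono)
      then show "\<bar>x - y\<bar> * r < d" using elim by (simp add: h_def)
    qed
    show ?case
    proof
      fix z :: complex assume z: "z \<in> sphere 0 r"
      define a where "a = Arg2pi z"
      have a: "0 \<le> a" "a \<le> 2 * pi" "z = of_real r * cis a"
        using z Arg2pi_ge_0[of z] Arg2pi_lt_2pi[of z] Arg2pi_eq[of z]
        by (auto simp: a_def cis_conv_exp mult_ac)
      have "u (z * cis (2 * pi * real k / real N)) = w (a + real k * h)" for k
        by (simp add: w_def a(3) h_def mult_ac flip: cis_mult)
      then have rm: "root_mean N u z = (\<Sum>k<N. w (a + real k * h)) / N"
        by (simp add: root_mean_def)
      have "\<bar>integral {a..a + 2 * pi} w - h * (\<Sum>k<N. w (a + real k * h))\<bar> \<le> 2 * pi * e"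
        using riemann_sum_error[OF w h(1) osch, of a N] h(2) by simp
      also have "h * (\<Sum>k<N. w (a + real k * h)) = 2 * pi * root_mean N u z"
        by (simp add: rm h_def)
      also have "integral {a..a + 2 * pi} w = 2 * pi * circle_mean u r"
        using integral_periodic[OF w per, of a] a by (simp add: circle_mean_def w_def[abs_def])
      also have "2 * pi * circle_mean u r - 2 * pi * root_mean N u z =
                 2 * pi * (circle_mean u r - root_mean N u z)"
        by (simp add: algebra_simps)
      finally show "\<bar>root_mean N u z - circle_mean u r\<bar> \<le> e"
        by (simp add: abs_mult abs_minus_commute)
    qed
  qed
qed

definition root_prod :: "nat \<Rightarrow> nat set \<Rightarrow> (complex \<Rightarrow> complex) \<Rightarrow> complex \<Rightarrow> complex" where
  "root_prod N S f z = (\<Prod>k\<in>S. f (z * cis (2 * pi * real k / real N)))"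

lemma exp_root_mean:
  assumes "N > 0"
  shows "exp (N * root_mean N (\<lambda>z. log_plus (norm (f z))) z) =
         (\<Prod>k<N. max 1 (norm (f (z * cis (2 * pi * real k / real N)))))"
  using assms by (simp add: root_mean_def exp_sum exp_log_plus)

lemma norm_root_prod_le:
  assumes "N > 0" and S: "S \<subseteq> {..<N}"
  shows "norm (root_prod N S f z) \<le> exp (N * root_mean N (\<lambda>z. log_plus (norm (f z))) z)"
proof -
  have "norm (root_prod N S f z) \<le> (\<Prod>k\<in>S. max 1 (norm (f (z * cis (2 * pi * real k / real N)))))"
    unfolding root_prod_def prod_norm[symmetric] by (intro prod_mono) auto
  also have "\<dots> \<le> (\<Prod>k<N. max 1 (norm (f (z * cis (2 * pi * real k / real N)))))"
    by (intro prod_mono2 S) auto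
  finally show ?thesis using assms by (simp add: exp_root_mean)
qed

text \<open>Rotates with \<bar>f\<bar> < 1 contribute the factor 1 to the right-hand side, so they
  are left out of S. As S depends on z, the upper bound for partial products is needed for every S
  at every other point.\<close>

lemma root_prod_attains:
  assumes "N > 0"
  obtains S where "S \<subseteq> {..<N}"
    "norm (root_prod N S f z) = exp (N * root_mean N (\<lambda>z. log_plus (norm (f z))) z)"
proof
  let ?S = "{k\<in>{..<N}. 1 \<le> norm (f (z * cis (2 * pi * real k / real N)))}"
  show "?S \<subseteq> {..<N}" by auto
  have "norm (root_prod N ?S f z) = (\<Prod>k\<in>?S. max 1 (norm (f (z * cis (2 * pi * real k / real N)))))"
    unfolding root_prod_def prod_norm[symmetric] by (intro prod.cong) auto
  also have "\<dots> = (\<Prod>k<N. max 1 (norm (f (z * cis (2 * pi * real k / real N)))))"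
    by (intro prod.mono_neutral_left) auto
  finally show "norm (root_prod N ?S f z) = exp (N * root_mean N (\<lambda>z. log_plus (norm (f z))) z)"
    using assms by (simp add: exp_root_mean)
qed

lemma root_prod_holomorphic:
  assumes "f holomorphic_on A" and rot: "\<And>z x. z \<in> A \<Longrightarrow> z * cis x \<in> A"
  shows "root_prod N S f holomorphic_on A"
  unfolding root_prod_def
  by (intro holomorphic_intros holomorphic_on_compose_gen[OF _ assms(1), unfolded o_def]) (auto intro: rot)

lemma continuous_on_log_plus_norm:
  assumes "f holomorphic_on A" "B \<subseteq> A"
  shows "continuous_on B (\<lambda>z. log_plus (norm (f z)))"
  using assms holomorphic_on_imp_continuous_on holomorphic_on_subset
  by (intro continuous_intros) blast

text \<open>
  The mean of \<open>log_plus \<bar>f\<bar>\<close> over the N-th roots of unity is the maximum of \<open>ln \<bar>H\<bar> / N\<close> over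
  holomorphic functions H, namely the partial products of the rotates of f. This reduces
  subharmonicity and convexity of circle means to the maximum modulus principle.
\<close>

lemma circle_mean_compare:
  fixes f :: "complex \<Rightarrow> complex" and \<alpha> \<beta> r :: real and Rs :: "real set"
  assumes hol: "f holomorphic_on A" and rot: "\<And>z x. z \<in> A \<Longrightarrow> z * cis x \<in> A"
    and fin: "finite Rs" and Rs: "\<And>R. R \<in> insert r Rs \<Longrightarrow> 0 \<le> R \<and> sphere 0 R \<subseteq> A"
    and le: "\<And>R. R \<in> Rs \<Longrightarrow> circle_mean (\<lambda>z. log_plus (norm (f z))) R \<le> \<alpha> * ln R + \<beta>"
    and principle: "\<And>(n::nat) H C z. H holomorphic_on A \<Longrightarrow>
      (\<And>w. norm w \<in> Rs \<Longrightarrow> norm (H w) \<le> exp (n * \<alpha> * ln (norm w) + C)) \<Longrightarrow>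
      norm z = r \<Longrightarrow> norm (H z) \<le> exp (n * \<alpha> * ln r + C)"
  shows "circle_mean (\<lambda>z. log_plus (norm (f z))) r \<le> \<alpha> * ln r + \<beta>"
proof (rule field_le_epsilon)
  fix e :: real assume "e > 0"
  \<comment> \<open>One half of e pays for the approximation on the circles in Rs, the other half
    for the one on the circle of radius r.\<close>
  then have e: "e / 2 > 0" by simp
  define u where "u = (\<lambda>z. log_plus (norm (f z)))"
  have "\<forall>\<^sub>F N in sequentially. \<forall>z\<in>sphere 0 R. \<bar>root_mean N u z - circle_mean u R\<bar> \<le> e / 2"
    if "R \<in> insert r Rs" for R
    unfolding u_def using Rs[OF that] e continuous_on_log_plus_norm[OF hol]
    by (intro root_mean_approx) auto
  then have "\<forall>\<^sub>F N in sequentially. \<forall>R\<in>insert r Rs.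
               \<forall>z\<in>sphere 0 R. \<bar>root_mean N u z - circle_mean u R\<bar> \<le> e / 2"
    using fin by (intro eventually_ball_finite) auto
  then have "\<forall>\<^sub>F N in sequentially. N > 0 \<and> (\<forall>R\<in>insert r Rs.
               \<forall>z\<in>sphere 0 R. \<bar>root_mean N u z - circle_mean u R\<bar> \<le> e / 2)"
    using eventually_gt_at_top[of 0] by eventually_elim auto
  then obtain N :: nat where "N > 0"
    and N: "\<And>R z. R \<in> insert r Rs \<Longrightarrow> norm z = R \<Longrightarrow> \<bar>root_mean N u z - circle_mean u R\<bar> \<le> e / 2"
    by (fastforce dest!: eventually_happens)
  define z where "z = complex_of_real r"
  have z: "norm z = r" using Rs[of r] by (simp add: z_def)
  obtain S where S: "S \<subseteq> {..<N}" "norm (root_prod N S f z) = exp (N * root_mean N u z)"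
    using root_prod_attains[OF \<open>N > 0\<close>] unfolding u_def by metis
  have "norm (root_prod N S f z) \<le> exp (N * \<alpha> * ln r + N * (\<beta> + e / 2))"
  proof (rule principle[OF root_prod_holomorphic[OF hol rot] _ z])
    fix w :: complex assume w: "norm w \<in> Rs"
    have "norm (root_prod N S f w) \<le> exp (N * root_mean N u w)"
      unfolding u_def by (rule norm_root_prod_le[OF \<open>N > 0\<close> S(1)])
    also have "root_mean N u w \<le> \<alpha> * ln (norm w) + \<beta> + e / 2"
      using N[OF insertI2, OF w refl] le[OF w, folded u_def] by linarith
    then have "exp (N * root_mean N u w) \<le> exp (N * (\<alpha> * ln (norm w) + \<beta> + e / 2))"
      by (simp add: mult_left_mono)
    also have "\<dots> = exp (N * \<alpha> * ln (norm w) + N * (\<beta> + e / 2))"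
      by (simp add: algebra_simps)
    finally show "norm (root_prod N S f w) \<le> \<dots>" .
  qed
  then have "N * root_mean N u z \<le> N * (\<alpha> * ln r + \<beta> + e / 2)"
    unfolding S(2) by (simp add: algebra_simps)
  then have "root_mean N u z \<le> \<alpha> * ln r + \<beta> + e / 2"
    using \<open>N > 0\<close> by simp
  then show "circle_mean (\<lambda>z. log_plus (norm (f z))) r \<le> \<alpha> * ln r + \<beta> + e"
    using N[OF insertI1 z] unfolding u_def by linarith
qed

text \<open>Stated on a disc because it is later applied to the composition with a Moebius map,
  which need not be entire. The case r = 0 is the sub-mean value property.\<close>

lemma circle_mean_log_plus_mono:
  assumes hol: "f holomorphic_on ball 0 R'" and r: "0 \<le> r" "r \<le> R" "R < R'"
  shows "circle_mean (\<lambda>z. log_plus (norm (f z))) r \<le> circle_mean (\<lambda>z. log_plus (norm (f z))) R"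
proof -
  \<comment> \<open>With slope 0 the comparison reduces to the maximum principle, and r = 0 is
    allowed whatever the value of \<open>ln 0\<close>.\<close>
  have "circle_mean (\<lambda>z. log_plus (norm (f z))) r \<le> 0 * ln r + circle_mean (\<lambda>z. log_plus (norm (f z))) R"
  proof (rule circle_mean_compare[OF hol, where Rs = "{R}"])
    fix n :: nat and H :: "complex \<Rightarrow> complex" and C :: real and z :: complex
    assume H: "H holomorphic_on ball 0 R'" "norm z = r"
      and le: "\<And>w. norm w \<in> {R} \<Longrightarrow> norm (H w) \<le> exp (real n * 0 * ln (norm w) + C)"
    show "norm (H z) \<le> exp (real n * 0 * ln r + C)"
    proof (rule maximum_modulus_frontier[of H "cball 0 R"])
      have sub: "cball 0 R \<subseteq> ball 0 R'" using r by auto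
      then show "continuous_on (closure (cball 0 R)) H"
        using H(1) by (auto intro: continuous_on_subset holomorphic_on_imp_continuous_on)
      show "H holomorphic_on interior (cball 0 R)"
        using H(1) sub interior_subset by (blast intro: holomorphic_on_subset)
      show "norm (H w) \<le> exp (real n * 0 * ln r + C)" if "w \<in> frontier (cball 0 R)" for w
        using le[of w] that by auto
    qed (use H r in auto)
  qed (use r in \<open>auto simp: norm_mult\<close>)
  then show ?thesis by simp
qed

text \<open>Hadamard's three circles theorem. The power \<open>z powr (- \<alpha>)\<close> is in
  general not single-valued on an annulus, so the annulus is pulled back by exp to a vertical
  strip.\<close>

lemma three_circles:
  assumes H: "H holomorphic_on UNIV" and r: "0 < r1" "r1 \<le> norm z" "norm z \<le> r2"
    and le: "\<And>w. norm w \<in> {r1, r2} \<Longrightarrow> norm (H w) \<le> exp (\<alpha> * ln (norm w) + C)"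
  shows "norm (H z) \<le> exp (\<alpha> * ln (norm z) + C)"
proof (cases "norm z \<in> {r1, r2}")
  case False
  then have z: "r1 < norm z" "norm z < r2" using r by auto
  define a b where "a = ln r1" and "b = ln r2"
  have "a < b" using z r by (simp add: a_def b_def)
  \<comment> \<open>\<open>\<bar>K (Ln z)\<bar> = \<bar>H z\<bar> * \<bar>z\<bar> powr (- \<alpha>)\<close>; since \<open>\<bar>K\<bar>\<close> has period \<open>2 * pi * \<i>\<close>, it attains its
    supremum over the strip, although the strip is not compact.\<close>
  define K where "K w = H (exp w) * exp (- of_real \<alpha> * w)" for w
  have hol: "K holomorphic_on UNIV" unfolding K_def
    by (intro holomorphic_intros holomorphic_on_compose_gen[OF _ H, unfolded o_def]) auto
  then have cont: "continuous_on A K" for A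
    using holomorphic_on_imp_continuous_on continuous_on_subset by blast
  \<comment> \<open>A vertical translation of w by a multiple of \<open>2 * pi * \<i>\<close>, which
    lands in the compact rectangle Q when \<open>a \<le> Re w \<le> b\<close>.\<close>
  define per where "per w = Complex (Re w) (Arg2pi (exp w))" for w
  have exp_per: "exp (per w) = exp w" for w
    by (metis (no_types, opaque_lifting) per_def Arg2pi_eq Complex_eq complex.sel exp_eq_polar norm_exp_eq_Re cis_conv_exp)
  have normK: "norm (K w) = norm (H (exp w)) * exp (- \<alpha> * Re w)" for w
    by (simp add: K_def norm_mult)
  define Q where "Q = cbox (Complex a 0) (Complex b (2 * pi))"
  have Q: "compact Q" "Q \<noteq> {}"
    using \<open>a < b\<close> by (auto simp: Q_def box_ne_empty Basis_complex_def)
  obtain w0 where w0: "w0 \<in> Q" "\<And>w. w \<in> Q \<Longrightarrow> norm (K w) \<le> norm (K w0)"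
    using continuous_attains_sup[OF Q, of "\<lambda>w. norm (K w)"] cont by (auto intro: continuous_intros)
  have w0_max: "norm (K w) \<le> norm (K w0)" if "a \<le> Re w" "Re w \<le> b" for w
  proof -
    have "per w \<in> Q"
      using that Arg2pi_ge_0[of "exp w"] Arg2pi_lt_2pi[of "exp w"]
      by (simp add: Q_def per_def in_cbox_complex_iff)
    from w0(2)[OF this] show ?thesis
      unfolding normK exp_per by (simp add: per_def)
  qed
  have bd: "norm (K w) \<le> exp C" if "Re w \<in> {a, b}" for w
  proof -
    have "norm (exp w) \<in> {r1, r2}" using that r z by (auto simp: a_def b_def)
    from le[OF this] have "norm (K w) \<le> exp (\<alpha> * Re w + C) * exp (- \<alpha> * Re w)"
      unfolding normK by (intro mult_right_mono) auto
    then show ?thesis by (simp flip: exp_add)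
  qed
  have "norm (K w0) \<le> exp C"
  proof (cases "Re w0 \<in> {a, b}")
    case False
    \<comment> \<open>A maximum inside the strip makes K constant on the open strip and, by
      continuity, on its closure; so it is also taken on the line \<open>Re w = a\<close>, where
      \<open>bd\<close> applies.\<close>
    define U where "U = {w. a < Re w} \<inter> {w. Re w < b}"
    have "w0 \<in> U" using w0(1) False by (auto simp: U_def Q_def in_cbox_complex_iff)
    have U: "open U" "connected U"
      by (auto simp: U_def open_halfspace_Re_gt open_halfspace_Re_lt intro!: convex_connected convex_Int convex_halfspace_Re_gt convex_halfspace_Re_lt)
    have "K constant_on U"
      by (rule maximum_modulus_principle[OF holomorphic_on_subset[OF hol] U U(1) order_refl \<open>w0 \<in> U\<close>])
        (auto simp: U_def intro!: w0_max)
    then have "K constant_on closure U"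
      by (intro constant_on_closureI cont)
    moreover have "of_real a \<in> closure U"
    proof -
      have "\<exists>y\<in>U. dist y (of_real a) < e" if "e > 0" for e
      proof -
        define x where "x = min (e / 2) ((b - a) / 2)"
        have "0 < x" "x < e" "a + x < b" using that \<open>a < b\<close> by (auto simp: x_def min_def field_simps)
        then show ?thesis
          by (intro bexI[of _ "of_real (a + x)"]) (auto simp: U_def dist_norm)
      qed
      then show ?thesis by (simp add: closure_approachable)
    qed
    ultimately have "K w0 = K (of_real a)"
      using \<open>w0 \<in> U\<close> closure_subset by (metis constant_on_def subsetD)
    then show ?thesis using bd[of "of_real a"] by simp
  qed (rule bd)
  moreover have "z \<noteq> 0" using z r by auto
  moreover from this have "norm (K (Ln z)) \<le> norm (K w0)"
    using z r by (intro w0_max) (auto simp: a_def b_def)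
  ultimately have "norm (H z) * exp (- \<alpha> * ln (norm z)) \<le> exp C"
    unfolding normK by simp
  then show ?thesis
    by (simp add: exp_minus exp_add field_simps)
qed (use le in auto)

lemma circle_mean_log_plus_three_circles:
  assumes f: "f holomorphic_on UNIV" and r: "0 < r1" "r1 \<le> r" "r \<le> r2"
    and "\<And>R. R \<in> {r1, r2} \<Longrightarrow> circle_mean (\<lambda>z. log_plus (norm (f z))) R \<le> \<alpha> * ln R + \<beta>"
  shows "circle_mean (\<lambda>z. log_plus (norm (f z))) r \<le> \<alpha> * ln r + \<beta>"
  by (rule circle_mean_compare[OF f, where Rs = "{r1, r2}"])
    (use assms three_circles[OF _ r(1), where ?r2.0 = r2] in auto)

lemma circle_mean_0: "circle_mean u 0 = u 0"
  by (simp add: circle_mean_def)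

text \<open>
  Apply the sub-mean value property to \<open>f \<circ> \<phi>\<close> for a Moebius automorphism \<open>\<phi>\<close> of the disc with
  \<open>\<phi> 0 = a\<close>. On the circle, \<open>\<phi> (cis \<theta>) = R * cis (\<Theta> \<theta>)\<close> with an explicit lift \<open>\<Theta>\<close> whose derivative is
  at least \<open>1/3\<close>, so substitution returns to the circle mean of f.
\<close>

lemma log_plus_norm_le_circle_mean:
  assumes f: "f holomorphic_on UNIV" and R: "0 < R" "norm a \<le> R / 4"
  shows "log_plus (norm (f a)) \<le> 3 * circle_mean (\<lambda>z. log_plus (norm (f z))) R"
proof -
  define b where "b = a / of_real R"
  have b: "norm b \<le> 1 / 4" using R by (simp add: b_def norm_divide field_simps)
  define \<phi> where "\<phi> \<zeta> = of_real R * (\<zeta> + b) / (1 + cnj b * \<zeta>)" for \<zeta>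
  define u where "u z = log_plus (norm (f z))" for z
  have u_cont: "continuous_on A u" for A
    unfolding u_def using continuous_on_log_plus_norm[OF f] by simp
  \<comment> \<open>Since \<open>norm b \<le> 1 / 4\<close>, any pole of \<phi> has norm at least 4,
    so \<open>f \<circ> \<phi>\<close> is holomorphic well beyond the closed unit disc.\<close>
  have denom: "0 < Re (1 + cnj b * \<zeta>)" if "norm \<zeta> < 4" for \<zeta>
  proof -
    have "\<bar>Re (cnj b * \<zeta>)\<bar> \<le> norm b * norm \<zeta>"
      using abs_Re_le_cmod[of "cnj b * \<zeta>"] by (simp add: norm_mult)
    also have "\<dots> \<le> 1 / 4 * norm \<zeta>"
      using b by (intro mult_right_mono) auto
    finally show ?thesis using that unfolding plus_complex.sel one_complex.sel by linarith
  qed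
  then have denom0: "1 + cnj b * \<zeta> \<noteq> 0" if "norm \<zeta> < 4" for \<zeta>
    using that by (metis less_irrefl zero_complex.sel(1))
  have hol: "(\<lambda>\<zeta>. f (\<phi> \<zeta>)) holomorphic_on ball 0 4"
    unfolding \<phi>_def using denom0
    by (intro holomorphic_on_compose_gen[OF _ f, unfolded o_def] holomorphic_intros) auto
  define d where "d \<theta> = 1 + cnj b * cis \<theta>" for \<theta>
  \<comment> \<open>On the unit circle
    \<open>cis \<theta> + b = cis \<theta> * cnj (d \<theta>)\<close>, so
    \<open>\<phi> (cis \<theta>)\<close> has the argument \<theta> minus twice that of
    \<open>d \<theta>\<close>. The principal logarithm is smooth along d because d stays in the
    right half-plane.\<close>
  define \<Theta> where "\<Theta> \<theta> = \<theta> - 2 * Im (Ln (d \<theta>))" for \<theta>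
  define \<Theta>' where "\<Theta>' \<theta> = 1 - 2 * Im (\<i> * (cnj b * cis \<theta>) / d \<theta>)" for \<theta>
  have d: "Re (d \<theta>) > 0" for \<theta> using denom[of "cis \<theta>"] by (simp add: d_def)
  have d0: "d \<theta> \<noteq> 0" for \<theta> using d[of \<theta>] by force
  have \<phi>_cis: "\<phi> (cis \<theta>) = of_real R * cis (\<Theta> \<theta>)" for \<theta>
  proof -
    have "cis (\<Theta> \<theta>) = cis \<theta> * cis (- Im (Ln (d \<theta>))) / cis (Im (Ln (d \<theta>)))"
      by (simp add: \<Theta>_def cis_mult cis_divide)
    also have "\<dots> = cis \<theta> * cnj (cis (Im (Ln (d \<theta>)))) / cis (Im (Ln (d \<theta>)))"
      by (simp add: cis_cnj)
    also have "\<dots> = cis \<theta> * cnj (d \<theta>) / d \<theta>"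
    proof -
      have "d \<theta> = of_real (norm (d \<theta>)) * cis (Im (Ln (d \<theta>)))"
        using exp_Ln[OF d0[of \<theta>]] Re_Ln[OF d0[of \<theta>]] by (metis exp_eq_polar cis_conv_exp norm_exp_eq_Re)
      then have "cnj (d \<theta>) / d \<theta> = cnj (cis (Im (Ln (d \<theta>)))) / cis (Im (Ln (d \<theta>)))"
        using d0[of \<theta>]
        by (metis (no_types, lifting) complex_cnj_complex_of_real complex_cnj_mult mult_divide_mult_cancel_left_if mult_zero_left)
      then show ?thesis by (metis times_divide_eq_right)
    qed
    also have "cis \<theta> * cnj (d \<theta>) = cis \<theta> + b"
      by (simp add: d_def cis_cnj distrib_left) (simp add: cis_mult mult.left_commute)
    finally show ?thesis by (simp add: \<phi>_def d_def)
  qed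
  have \<Theta>_deriv: "(\<Theta> has_real_derivative \<Theta>' \<theta>) (at \<theta> within A)" for \<theta> A
  proof -
    have "(d has_vector_derivative \<i> * (cnj b * cis \<theta>)) (at \<theta> within A)"
      unfolding d_def has_vector_derivative_def by (auto intro!: derivative_eq_intros)
    moreover have "(Ln has_field_derivative 1 / d \<theta>) (at (d \<theta>) within d ` A)"
      using has_field_derivative_Ln[of "d \<theta>"] d[of \<theta>]
      by (auto simp: complex_nonpos_Reals_iff inverse_eq_divide intro: has_field_derivative_at_within)
    ultimately have "((\<lambda>x. Ln (d x)) has_vector_derivative (\<i> * (cnj b * cis \<theta>) / d \<theta>)) (at \<theta> within A)"
      using field_vector_diff_chain_within[of d _ \<theta> A Ln "1 / d \<theta>"] by (simp add: o_def)
    then have "((\<lambda>x. Im (Ln (d x))) has_vector_derivative Im (\<i> * (cnj b * cis \<theta>) / d \<theta>)) (at \<theta> within A)"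
      using bounded_linear.has_vector_derivative[OF bounded_linear_Im] by blast
    then show ?thesis
      unfolding \<Theta>_def \<Theta>'_def has_real_derivative_iff_has_vector_derivative
      by (auto intro!: derivative_eq_intros)
  qed
  \<comment> \<open>The quotient has modulus at most
    \<open>norm b / (1 - norm b) \<le> 1 / 3\<close>, which leaves 1 - 2/3 = 1/3. Its reciprocal is
    the constant 3 of the inequality.\<close>
  have \<Theta>'_ge: "1 / 3 \<le> \<Theta>' \<theta>" for \<theta>
  proof -
    have "3 / 4 \<le> 1 - norm (cnj b * cis \<theta>)" using b by (simp add: norm_mult)
    also have "\<dots> \<le> norm (d \<theta>)"
      unfolding d_def using norm_diff_ineq[of 1 "cnj b * cis \<theta>"] by simp
    finally have le: "norm (\<i> * (cnj b * cis \<theta>) / d \<theta>) \<le> (1 / 4) / (3 / 4)"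
      unfolding norm_divide using b by (intro frac_le) (auto simp: norm_mult)
    have "\<bar>Im (\<i> * (cnj b * cis \<theta>) / d \<theta>)\<bar> \<le> norm (\<i> * (cnj b * cis \<theta>) / d \<theta>)"
      by (rule abs_Im_le_cmod)
    also note le
    also have "(1 / 4) / (3 / 4) = (1 / 3 :: real)" by simp
    finally have "Im (\<i> * (cnj b * cis \<theta>) / d \<theta>) \<le> 1 / 3"
      by (rule abs_le_D1)
    then show ?thesis by (simp add: \<Theta>'_def)
  qed
  define w where "w \<tau> = u (of_real R * cis \<tau>)" for \<tau>
  have w: "continuous_on A w" for A
    unfolding w_def by (rule continuous_on_compose2[OF u_cont]) (auto intro!: continuous_intros)
  have w_nonneg: "w \<tau> \<ge> 0" for \<tau> by (simp add: w_def u_def)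
  have per: "w (x + 2 * pi) = w x" for x
    by (simp add: w_def cis_mult[symmetric])
  have \<Theta>_2pi: "\<Theta> (2 * pi) = \<Theta> 0 + 2 * pi" by (simp add: \<Theta>_def d_def)
  have \<Theta>_cont: "continuous_on A \<Theta>" for A
    by (rule DERIV_continuous_on[OF \<Theta>_deriv])
  have "compact (\<Theta> ` {0..2 * pi})"
    by (intro compact_continuous_image \<Theta>_cont) auto
  then obtain l m where lm: "\<Theta> ` {0..2 * pi} \<subseteq> {l..m}"
    by (metis bounded_subset_cbox_symmetric compact_imp_bounded interval_cbox)
  have int: "((\<lambda>x. \<Theta>' x *\<^sub>R w (\<Theta> x)) has_integral integral {\<Theta> 0..\<Theta> (2 * pi)} w) {0..2 * pi}"
    by (rule has_integral_substitution[OF _ _ lm w \<Theta>_deriv]) (auto simp: \<Theta>_2pi)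
  have "\<bar>\<Theta> 0\<bar> \<le> 2 * pi"
    using Re_Ln_pos_lt[OF d0[of 0]] d[of 0] by (simp add: \<Theta>_def)
  have "integral {0..2 * pi} (\<lambda>x. w (\<Theta> x)) \<le> 3 * integral {\<Theta> 0..\<Theta> (2 * pi)} w"
  proof (rule has_integral_le)
    show "((\<lambda>x. w (\<Theta> x)) has_integral integral {0..2 * pi} (\<lambda>x. w (\<Theta> x))) {0..2 * pi}"
      by (intro integrable_integral integrable_continuous_real continuous_on_compose2[OF w \<Theta>_cont]) auto
    show "((\<lambda>x. 3 * (\<Theta>' x *\<^sub>R w (\<Theta> x))) has_integral 3 * integral {\<Theta> 0..\<Theta> (2 * pi)} w) {0..2 * pi}"
      by (rule has_integral_mult_right[OF int])
    show "w (\<Theta> x) \<le> 3 * (\<Theta>' x *\<^sub>R w (\<Theta> x))" for x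
      using mult_right_mono[OF \<Theta>'_ge[of x] w_nonneg[of "\<Theta> x"]] by simp
  qed
  also have "integral {\<Theta> 0..\<Theta> (2 * pi)} w = integral {0..2 * pi} w"
    unfolding \<Theta>_2pi by (rule integral_periodic[OF w per]) fact
  finally have int_le: "integral {0..2 * pi} (\<lambda>x. w (\<Theta> x)) \<le> 3 * integral {0..2 * pi} w" .
  have "u (\<phi> 0) = circle_mean (\<lambda>\<zeta>. log_plus (norm (f (\<phi> \<zeta>)))) 0"
    by (simp add: circle_mean_0 u_def)
  also have "\<dots> \<le> circle_mean (\<lambda>\<zeta>. log_plus (norm (f (\<phi> \<zeta>)))) 1"
    by (rule circle_mean_log_plus_mono[OF hol]) auto
  also have "\<dots> = 1 / (2 * pi) * integral {0..2 * pi} (\<lambda>x. w (\<Theta> x))"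
    by (simp add: circle_mean_def \<phi>_cis w_def u_def)
  also have "\<dots> \<le> 1 / (2 * pi) * (3 * integral {0..2 * pi} w)"
    by (intro mult_left_mono int_le) auto
  also have "1 / (2 * pi) * (3 * integral {0..2 * pi} w) = 3 * circle_mean u R"
    by (simp add: circle_mean_def w_def[abs_def])
  finally have "u (\<phi> 0) \<le> 3 * circle_mean u R" .
  moreover have "\<phi> 0 = a" using R by (simp add: \<phi>_def b_def)
  ultimately show ?thesis by (simp add: u_def[abs_def])
qed

section \<open>The characteristic of an entire function\<close>

lemma nevanlinna_char_eq:
  "nevanlinna_char f r = circle_mean (\<lambda>z. log_plus (norm (f z))) r + counting_fun f r"
  by (simp add: nevanlinna_char_def proximity_fun_def circle_mean_def log_plus_def)

lemma entire_no_poles: "g holomorphic_on UNIV \<Longrightarrow> \<not> is_pole g z"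
  by (rule not_is_pole_holomorphic[of UNIV]) auto

lemma nevanlinna_char_no_poles:
  assumes "\<And>z. \<not> is_pole f z"
  shows "nevanlinna_char f r = circle_mean (\<lambda>z. log_plus (norm (f z))) r"
  using assms by (simp add: nevanlinna_char_eq counting_fun_def pole_count_def)

lemma circle_mean_nonneg:
  assumes "\<And>z. u z \<ge> 0"
  shows "circle_mean u r \<ge> 0"
proof (cases "(\<lambda>\<theta>. u (of_real r * cis \<theta>)) integrable_on {0..2*pi}")
  case True
  then show ?thesis unfolding circle_mean_def
    using assms by (intro mult_nonneg_nonneg integral_nonneg) auto
next
  case False
  then show ?thesis by (simp add: circle_mean_def not_integrable_integral)
qed

context
  fixes g :: "complex \<Rightarrow> complex"
  assumes hol: "g holomorphic_on UNIV"
begin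

private lemma char_eq: "nevanlinna_char g r = circle_mean (\<lambda>z. log_plus (norm (g z))) r"
  by (rule nevanlinna_char_no_poles) (rule entire_no_poles[OF hol])

lemma nevanlinna_char_nonneg: "0 \<le> nevanlinna_char g r"
  by (simp add: char_eq circle_mean_nonneg)

lemma nevanlinna_char_mono:
  assumes "0 \<le> r" "r \<le> R"
  shows "nevanlinna_char g r \<le> nevanlinna_char g R"
  unfolding char_eq
  by (rule circle_mean_log_plus_mono[OF holomorphic_on_subset[OF hol], of "R + 1"]) (use assms in auto)

text \<open>The right-hand side is the chord, in the variable \<open>ln r\<close>, between the radii
  1 and R. Radius 1 is the left end because ln 1 = 0.\<close>

lemma nevanlinna_char_log_convex:
  assumes r: "1 < r" "r \<le> R"
  shows "nevanlinna_char g r \<le>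
           nevanlinna_char g 1 + (nevanlinna_char g R - nevanlinna_char g 1) * (ln r / ln R)"
proof -
  let ?\<alpha> = "(nevanlinna_char g R - nevanlinna_char g 1) / ln R"
  have "nevanlinna_char g r \<le> ?\<alpha> * ln r + nevanlinna_char g 1"
    unfolding char_eq by (rule circle_mean_log_plus_three_circles[OF hol, of 1 _ R]) (use r in auto)
  then show ?thesis by simp
qed

lemma nevanlinna_char_continuous: "continuous_on A (nevanlinna_char g)"
proof -
  have "continuous_on A (\<lambda>r. integral (cbox 0 (2 * pi)) (\<lambda>\<theta>. log_plus (norm (g (of_real r * cis \<theta>)))))"
    by (intro integral_continuous_on_param)
      (auto simp: case_prod_unfold intro!: continuous_intros
         continuous_on_compose2[OF holomorphic_on_imp_continuous_on[OF hol]])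
  then show ?thesis
    by (auto simp: char_eq[abs_def] circle_mean_def intro!: continuous_intros)
qed

lemma norm_le_max_modulus:
  assumes "norm z = r"
  shows "norm (g z) \<le> max_modulus g r"
proof -
  have "compact ((\<lambda>z. norm (g z)) ` sphere 0 r)"
    by (intro compact_continuous_image continuous_intros continuous_on_subset[OF holomorphic_on_imp_continuous_on[OF hol]]) auto
  then show ?thesis unfolding max_modulus_def
    using assms by (intro cSUP_upper) (auto intro: bounded_imp_bdd_above compact_imp_bounded)
qed

lemma max_modulus_attained:
  assumes "r \<ge> 0"
  obtains z where "norm z = r" "norm (g z) = max_modulus g r"
proof -
  have "of_real r \<in> sphere (0::complex) r" using assms by simp
  then have "sphere (0::complex) r \<noteq> {}" by blast
  then obtain z where z: "z \<in> sphere 0 r" "\<And>w. w \<in> sphere 0 r \<Longrightarrow> norm (g w) \<le> norm (g z)"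
    using continuous_attains_sup[of "sphere 0 r" "\<lambda>z. norm (g z)"]
      continuous_on_subset[OF holomorphic_on_imp_continuous_on[OF hol]]
    by (force intro: continuous_intros)
  then have "max_modulus g r \<le> norm (g z)"
    unfolding max_modulus_def by (intro cSUP_least) auto
  then show ?thesis using that[of z] z(1) norm_le_max_modulus[of z r] by simp
qed

lemma nevanlinna_char_le_log_plus_max_modulus:
  assumes "r \<ge> 0"
  shows "nevanlinna_char g r \<le> log_plus (max_modulus g r)"
proof -
  have "integral {0..2*pi} (\<lambda>\<theta>. log_plus (norm (g (of_real r * cis \<theta>)))) \<le>
         integral {0..2*pi} (\<lambda>\<theta>. log_plus (max_modulus g r))"
    by (intro integral_le integrable_continuous_real continuous_intros log_plus_mono norm_le_max_modulus
         continuous_on_compose2[OF holomorphic_on_imp_continuous_on[OF hol]])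
       (use assms in \<open>auto simp: norm_mult\<close>)
  then show ?thesis by (simp add: char_eq circle_mean_def field_simps)
qed

text \<open>The maximum is attained at a point whose norm is a quarter of the radius 4 r, as the
  Harnack inequality requires. Together with the bound of T by the logarithm of the maximum modulus,
  this transfers growth conditions on the modulus to T.\<close>

lemma log_plus_max_modulus_le:
  assumes "r > 0"
  shows "log_plus (max_modulus g r) \<le> 3 * nevanlinna_char g (4 * r)"
proof -
  obtain z where "norm z = r" "norm (g z) = max_modulus g r"
    using max_modulus_attained[of r] assms by auto
  then show ?thesis
    using log_plus_norm_le_circle_mean[OF hol, of "4 * r" z] assms by (simp add: char_eq)
qed

end

context
  fixes g :: "complex \<Rightarrow> complex"
  assumes g: "nonconst_entire g"
begin

private lemma hol: "g holomorphic_on UNIV"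
  using g by (simp add: nonconst_entire_def)

text \<open>Liouville's theorem gives one large value of \<bar>g\<bar>; the Harnack inequality then
  makes T large at every radius from four times the norm of that point on.\<close>

lemma nevanlinna_char_at_top: "filterlim (nevanlinna_char g) at_top at_top"
  unfolding filterlim_at_top
proof
  fix K :: real
  have "\<not> bounded (range g)"
    using g Liouville_theorem[OF hol] by (auto simp: nonconst_entire_def constant_on_def)
  then obtain a where a: "norm (g a) > exp (3 * K)"
    by (metis boundedI not_le rangeE)
  have *: "K \<le> nevanlinna_char g R" if "R \<ge> 4 * norm a" "R > 0" for R
  proof -
    have "3 * K = ln (exp (3 * K))" by simp
    also have "\<dots> \<le> ln (max 1 (norm (g a)))"
      using a by (subst ln_le_cancel_iff) auto
    also have "\<dots> \<le> 3 * nevanlinna_char g R"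
      using log_plus_norm_le_circle_mean[OF hol \<open>R > 0\<close>, of a] that
      by (simp add: nevanlinna_char_no_poles entire_no_poles[OF hol] log_plus_def)
    finally show ?thesis by simp
  qed
  show "\<forall>\<^sub>F R in at_top. K \<le> nevanlinna_char g R"
    using eventually_ge_at_top[of "4 * norm a"] eventually_gt_at_top[of 0]
    by eventually_elim (rule *)
qed

text \<open>T can be constant near 0, so strictness is claimed only once T has risen above its value
  at 1; the chord then has positive slope.\<close>

lemma nevanlinna_char_strict_mono:
  assumes r: "1 < r" "r < R" and gt: "nevanlinna_char g 1 < nevanlinna_char g R"
  shows "nevanlinna_char g r < nevanlinna_char g R"
proof -
  have "nevanlinna_char g r \<le>
          nevanlinna_char g 1 + (nevanlinna_char g R - nevanlinna_char g 1) * (ln r / ln R)"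
    using r by (intro nevanlinna_char_log_convex[OF hol]) auto
  also have "(nevanlinna_char g R - nevanlinna_char g 1) * (ln r / ln R) <
             (nevanlinna_char g R - nevanlinna_char g 1) * 1"
    using r gt by (intro mult_strict_left_mono) auto
  finally show ?thesis by simp
qed

text \<open>The inverse is a definite description over all positive radii, so uniqueness is needed
  there: monotonicity puts every preimage of y beyond 1, and strict monotonicity takes over from
  there.\<close>

lemma nevanlinna_char_inv:
  assumes y: "nevanlinna_char g 1 < y"
  shows "1 < nevanlinna_char_inv g y" and "nevanlinna_char g (nevanlinna_char_inv g y) = y"
proof -
  have "\<forall>\<^sub>F R in at_top. y \<le> nevanlinna_char g R"
    using nevanlinna_char_at_top by (auto simp: filterlim_at_top)
  then have "\<forall>\<^sub>F R in at_top. y \<le> nevanlinna_char g R \<and> 1 \<le> R"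
    using eventually_ge_at_top[of 1] by eventually_elim auto
  then obtain R where R: "y \<le> nevanlinna_char g R" "1 \<le> R"
    by (auto dest: eventually_happens)
  have "\<exists>r\<ge>1. r \<le> R \<and> nevanlinna_char g r = y"
    using R y by (intro IVT' nevanlinna_char_continuous[OF hol]) auto
  then obtain r where r: "1 \<le> r" "nevanlinna_char g r = y" by auto
  then have "r > 1" using y by (cases "r = 1") auto
  have gt1: "x > 1" if "x > 0" "nevanlinna_char g x = y" for x
    using nevanlinna_char_mono[OF hol, of x 1] that y by force
  have "nevanlinna_char_inv g y = r"
    unfolding nevanlinna_char_inv_def the_inv_into_def
  proof (rule the_equality)
    fix x assume x: "x \<in> {0<..} \<and> nevanlinna_char g x = y"
    then have "x > 1" using gt1 by auto
    then show "x = r"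
      using nevanlinna_char_strict_mono[of x r] nevanlinna_char_strict_mono[of r x] x r \<open>r > 1\<close> y
      by (cases x r rule: linorder_cases) auto
  qed (use r in auto)
  then show "1 < nevanlinna_char_inv g y" "nevanlinna_char g (nevanlinna_char_inv g y) = y"
    using r \<open>r > 1\<close> by auto
qed

lemma nevanlinna_char_inv_le_iff:
  assumes y: "nevanlinna_char g 1 < y" and x: "0 < x"
  shows "nevanlinna_char_inv g y \<le> x \<longleftrightarrow> y \<le> nevanlinna_char g x"
proof
  assume "nevanlinna_char_inv g y \<le> x"
  then show "y \<le> nevanlinna_char g x"
    using nevanlinna_char_inv[OF y] nevanlinna_char_mono[OF hol, of "nevanlinna_char_inv g y" x] by simp
next
  assume le: "y \<le> nevanlinna_char g x"
  show "nevanlinna_char_inv g y \<le> x"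
  proof (rule ccontr)
    assume "\<not> nevanlinna_char_inv g y \<le> x"
    moreover have "x > 1" using nevanlinna_char_mono[OF hol, of x 1] le x y by force
    ultimately show False
      using nevanlinna_char_strict_mono[of x "nevanlinna_char_inv g y"] nevanlinna_char_inv[OF y] le y
      by simp
  qed
qed

lemma nevanlinna_char_inv_at_top: "filterlim (nevanlinna_char_inv g) at_top at_top"
  unfolding filterlim_at_top
proof
  fix K :: real
  let ?K = "max K 1"
  show "\<forall>\<^sub>F y in at_top. K \<le> nevanlinna_char_inv g y"
    using eventually_gt_at_top[of "nevanlinna_char g ?K"]
  proof eventually_elim
    case (elim y)
    then have "nevanlinna_char g 1 < y"
      using nevanlinna_char_mono[OF hol, of 1 ?K] by simp
    then show ?case using nevanlinna_char_inv_le_iff[of y ?K] elim by force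
  qed
qed

lemma nevanlinna_char_powr_gt1:
  assumes "1 < \<sigma>"
  obtains \<kappa> where "\<kappa> < 1"
    "\<forall>\<^sub>F R in at_top. nevanlinna_char g R \<le> \<kappa> * nevanlinna_char g (R powr \<sigma>)"
proof
  \<comment> \<open>Half of the gap between 1 / \<sigma> and 1. Convexity gives
    \<open>T R \<le> T 1 + T (R powr \<sigma>) / \<sigma>\<close>, and the constant T 1 is
    eventually at most \<open>\<delta> * T (R powr \<sigma>)\<close>.\<close>
  define \<delta> where "\<delta> = (1 - 1 / \<sigma>) / 2"
  have \<delta>: "\<delta> > 0" using assms by (simp add: \<delta>_def)
  show "1 / \<sigma> + \<delta> < 1" using assms by (simp add: \<delta>_def field_simps)
  have "filterlim (\<lambda>R. nevanlinna_char g (R powr \<sigma>)) at_top at_top"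
    using assms by (intro filterlim_compose[OF nevanlinna_char_at_top]) real_asymp
  then have "\<forall>\<^sub>F R in at_top. nevanlinna_char g 1 / \<delta> \<le> nevanlinna_char g (R powr \<sigma>)"
    by (auto simp: filterlim_at_top)
  then show "\<forall>\<^sub>F R in at_top. nevanlinna_char g R \<le> (1 / \<sigma> + \<delta>) * nevanlinna_char g (R powr \<sigma>)"
    using eventually_gt_at_top[of 1]
  proof eventually_elim
    case (elim R)
    have "R powr 1 \<le> R powr \<sigma>" using elim assms by (intro powr_mono) auto
    then have "nevanlinna_char g R \<le> nevanlinna_char g 1 +
        (nevanlinna_char g (R powr \<sigma>) - nevanlinna_char g 1) * (ln R / ln (R powr \<sigma>))"
      using elim by (intro nevanlinna_char_log_convex[OF hol]) auto
    also have "ln R / ln (R powr \<sigma>) = 1 / \<sigma>"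
      using elim by (simp add: ln_powr)
    also have "nevanlinna_char g 1 + (nevanlinna_char g (R powr \<sigma>) - nevanlinna_char g 1) * (1 / \<sigma>) \<le>
               nevanlinna_char g 1 + nevanlinna_char g (R powr \<sigma>) * (1 / \<sigma>)"
      using assms nevanlinna_char_nonneg[OF hol, of 1] by (intro add_left_mono mult_right_mono) auto
    also have "nevanlinna_char g 1 \<le> \<delta> * nevanlinna_char g (R powr \<sigma>)"
      using elim \<delta> by (simp add: field_simps)
    finally show ?case by (simp add: algebra_simps)
  qed
qed

end

section \<open>Consequences of Property (A) for the characteristic\<close>

lemma max_modulus_power_le:
  assumes A: "property_A g" and "1 < \<sigma>"
  shows "\<forall>\<^sub>F r in at_top. max_modulus g r ^ (2 ^ n) \<le> max_modulus g (r powr (\<sigma> ^ n))"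
proof (induction n)
  case 0
  show ?case using eventually_gt_at_top[of 0] by eventually_elim simp
next
  case (Suc n)
  have hol: "g holomorphic_on UNIV" using A by (simp add: property_A_def nonconst_entire_def)
  have "\<sigma> ^ n > 0" using assms by simp
  then have "filterlim (\<lambda>r. r powr (\<sigma> ^ n)) at_top at_top" by real_asymp
  moreover have "\<forall>\<^sub>F r in at_top. (max_modulus g r)\<^sup>2 \<le> max_modulus g (r powr \<sigma>)"
    using assms by (simp add: property_A_def)
  ultimately have "\<forall>\<^sub>F r in at_top. (max_modulus g (r powr (\<sigma> ^ n)))\<^sup>2 \<le> max_modulus g ((r powr (\<sigma> ^ n)) powr \<sigma>)"
    by (rule eventually_compose_filterlim[rotated])
  with Suc show ?case using eventually_ge_at_top[of 0]
  proof eventually_elim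
    case (elim r)
    obtain z where "norm (g z) = max_modulus g r" by (rule max_modulus_attained[OF hol elim(3)])
    then have "max_modulus g r \<ge> 0" by (metis norm_ge_zero)
    have "max_modulus g r ^ (2 ^ Suc n) = (max_modulus g r ^ (2 ^ n))\<^sup>2"
      by (simp add: power_mult[symmetric] mult.commute)
    also have "\<dots> \<le> (max_modulus g (r powr (\<sigma> ^ n)))\<^sup>2"
      using elim \<open>max_modulus g r \<ge> 0\<close> by (intro power_mono) auto
    also note elim(2)
    finally show ?case by (simp add: powr_powr mult.commute)
  qed
qed

text \<open>Iterating Property (A) n times multiplies the logarithm of the modulus by 2 ^ n, while
  the exponent of the radius can be kept close to 1. Passing between modulus and T costs only fixed
  factors.\<close>

lemma nevanlinna_char_powr_property_A:
  assumes A: "property_A g" and "1 < \<delta>"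
  shows "\<forall>\<^sub>F R in at_top. K * nevanlinna_char g R \<le> nevanlinna_char g (R powr \<delta>)"
proof -
  have g: "nonconst_entire g" and hol: "g holomorphic_on UNIV"
    using A by (auto simp: property_A_def nonconst_entire_def)
  obtain n where n: "3 * K < 2 ^ n" using real_arch_pow[of 2 "3 * K"] by auto
  \<comment> \<open>With a root of order n + 1, the n iterations use only the exponent
    \<open>\<sigma> ^ n < \<delta>\<close>. The remaining power of R absorbs the factor 4 in the
    radius from the Harnack inequality; its factor 3 sits in the choice of n.\<close>
  define \<sigma> where "\<sigma> = root (Suc n) \<delta>"
  have \<sigma>: "1 < \<sigma>" "\<sigma> ^ Suc n = \<delta>" using assms by (auto simp: \<sigma>_def simp del: power_Suc)
  have "\<sigma> ^ n < \<sigma> ^ Suc n" using \<sigma> by (intro power_strict_increasing) auto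
  then have "\<forall>\<^sub>F R in at_top. 4 * R powr (\<sigma> ^ n) \<le> R powr \<delta>"
    using \<sigma> by (simp del: power_Suc) real_asymp
  moreover have "\<forall>\<^sub>F R in at_top. 1 \<le> nevanlinna_char g R"
    using nevanlinna_char_at_top[OF g] by (auto simp: filterlim_at_top)
  ultimately show ?thesis
    using max_modulus_power_le[OF A \<sigma>(1), of n] eventually_gt_at_top[of 0]
  proof eventually_elim
    case (elim R)
    let ?M = "max_modulus g R" and ?M' = "max_modulus g (R powr (\<sigma> ^ n))"
    have T: "nevanlinna_char g R \<le> log_plus ?M"
      using elim by (intro nevanlinna_char_le_log_plus_max_modulus[OF hol]) auto
    \<comment> \<open>As T is at least 1 here, the modulus exceeds 1 and the positive part of its
      logarithm is the logarithm itself.\<close>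
    then have "ln (max 1 ?M) > 0" using elim unfolding log_plus_def by linarith
    then have M1: "?M > 1" by (simp add: max_def split: if_splits)
    have "3 * K * nevanlinna_char g R \<le> 2 ^ n * nevanlinna_char g R"
      using n elim by (intro mult_right_mono) auto
    also have "\<dots> \<le> 2 ^ n * log_plus ?M"
      using T by simp
    also have "\<dots> = ln (?M ^ (2 ^ n))"
      using M1 by (simp add: log_plus_def ln_realpow)
    also have "\<dots> \<le> log_plus ?M'"
      unfolding log_plus_def using M1 elim(3) by (intro ln_mono) auto
    also have "\<dots> \<le> 3 * nevanlinna_char g (4 * R powr (\<sigma> ^ n))"
      using elim by (intro log_plus_max_modulus_le[OF hol]) auto
    also have "\<dots> \<le> 3 * nevanlinna_char g (R powr \<delta>)"
      using elim by (intro mult_left_mono nevanlinna_char_mono[OF hol]) auto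
    finally show ?case by simp
  qed
qed

section \<open>The characteristic of a meromorphic function\<close>

lemma integrable_inverse_sqrt_abs:
  fixes x u v :: real
  shows "(\<lambda>t. inverse (sqrt \<bar>t - x\<bar>)) integrable_on {u..v}"
proof (cases "u \<le> v")
  case True
  have "((\<lambda>t. inverse (sqrt \<bar>t - x\<bar>)) has_integral (2 * sqrt (v - x) - 2 * sqrt (u - x))) {u..v}"
  proof (rule fundamental_theorem_of_calculus_interior_strong[OF _ True])
    show "finite {x}" by simp
    \<comment> \<open>\<open>sqrt\<close> is odd on the reals, so this one formula is a continuous
      primitive on both sides of the singularity x.\<close>
    show "continuous_on {u..v} (\<lambda>t. 2 * sqrt (t - x))" by (intro continuous_intros)
    fix t assume "t \<in> {u<..<v} - {x}"
    then have ne: "t - x \<noteq> 0" by simp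
    have "(sqrt has_real_derivative inverse (sqrt \<bar>t - x\<bar>) / 2) (at (t - x))"
      by (rule DERIV_real_sqrt_generic[OF ne])
        (use real_sqrt_minus[of "x - t"] in \<open>auto simp: abs_if\<close>)
    then have "((\<lambda>t. 2 * sqrt (t - x)) has_real_derivative 2 * (inverse (sqrt \<bar>t - x\<bar>) / 2 * (1 - 0))) (at t)"
      by (intro DERIV_cmult DERIV_chain2 derivative_intros) auto
    then show "((\<lambda>t. 2 * sqrt (t - x)) has_vector_derivative inverse (sqrt \<bar>t - x\<bar>)) (at t)"
      by (simp add: has_real_derivative_iff_has_vector_derivative)
  qed
  then show ?thesis by blast
qed auto

text \<open>At a pole, C bounds the holomorphic factor that remains after the power of
  \<open>w - z\<close> is split off; otherwise n = 0 works. \<open>C \<ge> 1\<close> keeps the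
  majorant at least 1 near z, as the passage to \<open>log_plus\<close> requires.\<close>

lemma meromorphic_norm_bound:
  assumes "f meromorphic_on {z}"
  obtains C n where "C \<ge> 1" "\<forall>\<^sub>F w in at z. norm (f w) \<le> C / norm (w - z) ^ n"
proof -
  have sing: "isolated_singularity_at f z" "not_essential f z"
    using assms by (auto simp: meromorphic_at_iff)
  show ?thesis
  proof (cases "is_pole f z")
    case False
    then obtain L where "f \<midarrow>z\<rightarrow> L" using sing(2) by (auto simp: not_essential_def)
    then have "\<forall>\<^sub>F w in at z. norm (f w) < norm L + 1"
      by (intro order_tendstoD(2)[OF tendsto_norm]) auto
    then have "\<forall>\<^sub>F w in at z. norm (f w) \<le> (norm L + 1) / norm (w - z) ^ 0"
      by eventually_elim simp
    then show ?thesis by (intro that[of "norm L + 1" 0]) auto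
  next
    case True
    obtain r where r: "r > 0" "f holomorphic_on ball z r - {z}"
      using sing(1) analytic_imp_holomorphic by (auto simp: isolated_singularity_at_def)
    obtain e where e: "e > 0" "zor_poly f z holomorphic_on cball z e"
      "\<And>w. w \<in> cball z e - {z} \<Longrightarrow> f w = zor_poly f z w / (w - z) ^ nat (- zorder f z)"
      using zorder_exist_pole[OF r(2) _ _ True] r(1) by auto
    have "compact (zor_poly f z ` cball z e)"
      by (intro compact_continuous_image holomorphic_on_imp_continuous_on[OF e(2)]) auto
    then obtain C where C: "\<And>w. w \<in> cball z e \<Longrightarrow> norm (zor_poly f z w) \<le> C"
      by (metis bounded_iff compact_imp_bounded imageI)
    have "\<forall>\<^sub>F w in at z. norm (f w) \<le> max 1 C / norm (w - z) ^ nat (- zorder f z)"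
      unfolding eventually_at
    proof (intro exI[of _ e] conjI ballI impI e(1))
      fix w assume "w \<noteq> z \<and> dist w z < e"
      then have "w \<in> cball z e - {z}" by (auto simp: dist_commute)
      then show "norm (f w) \<le> max 1 C / norm (w - z) ^ nat (- zorder f z)"
        using C[of w] e(3)[of w] by (auto simp: norm_divide norm_power intro!: divide_right_mono)
    qed
    then show ?thesis by (intro that[of "max 1 C"]) auto
  qed
qed

text \<open>The logarithmic singularity is traded for an inverse square root, by
  \<open>ln y \<le> y\<close> at \<open>y = 1 / sqrt d\<close>; that majorant has an elementary
  primitive.\<close>

lemma log_plus_pole_bound:
  assumes C: "C \<ge> 1" and d: "0 < d" "d < 1" and x: "x \<le> C / d ^ n"
  shows "log_plus x \<le> ln C + 2 * real n * inverse (sqrt d)"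
proof -
  have "1 \<le> C / d ^ n" using C d power_le_one[of d n] by (simp add: field_simps)
  then have "log_plus x \<le> ln (C / d ^ n)"
    using x by (auto simp: log_plus_def)
  also have "\<dots> = ln C + real n * ln (inverse d)"
    using C d by (simp add: ln_div ln_realpow ln_inverse)
  also have "ln (inverse d) = 2 * ln (inverse (sqrt d))"
    using d by (simp add: ln_inverse ln_sqrt)
  also have "ln (inverse (sqrt d)) \<le> inverse (sqrt d)"
    using d ln_bound[of "inverse (sqrt d)"] by simp
  finally show ?thesis by (simp add: mult_left_mono mult.assoc)
qed

text \<open>Near any point x the integrand is continuous except at x and dominated by an integrable
  inverse square root. Integrability on small subintervals around every point suffices on a compact
  interval.\<close>

lemma integrable_log_plus_meromorphic_real_line:
  assumes h: "h meromorphic_on UNIV"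
  shows "(\<lambda>t::real. log_plus (norm (h (of_real t)))) integrable_on {a..b}"
  unfolding interval_cbox
proof (rule integrable_on_little_subintervals, intro ballI)
  let ?F = "\<lambda>t::real. log_plus (norm (h (of_real t)))"
  fix x :: real
  have hx: "h meromorphic_on {of_real x}" using h by (rule meromorphic_on_subset) simp
  obtain C n where C: "C \<ge> 1"
    and ev: "\<forall>\<^sub>F w in at (of_real x). norm (h w) \<le> C / norm (w - of_real x) ^ n"
    using meromorphic_norm_bound[OF hx] by blast
  obtain d1 where d1: "d1 > 0"
    "\<And>w. w \<noteq> of_real x \<Longrightarrow> dist w (of_real x) < d1 \<Longrightarrow> norm (h w) \<le> C / norm (w - of_real x) ^ n"
    using ev unfolding eventually_at by blast
  obtain d2 where d2: "d2 > 0" "h holomorphic_on ball (of_real x) d2 - {of_real x}"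
    using hx analytic_imp_holomorphic by (auto simp: meromorphic_at_iff isolated_singularity_at_def)
  define d where "d = min 1 (min d1 d2)"
  show "\<exists>d>0. \<forall>u v. x \<in> cbox u v \<and> cbox u v \<subseteq> ball x d \<and> cbox u v \<subseteq> cbox a b \<longrightarrow> ?F integrable_on cbox u v"
  proof (intro exI[of _ d] conjI allI impI)
    show "d > 0" using d1 d2 by (simp add: d_def)
    fix u v assume *: "x \<in> cbox u v \<and> cbox u v \<subseteq> ball x d \<and> cbox u v \<subseteq> cbox a b"
    have near: "of_real t \<noteq> (of_real x :: complex)" "dist (of_real t) (of_real x :: complex) = \<bar>t - x\<bar>" "\<bar>t - x\<bar> < d"
      if "t \<in> {u..v} - {x}" for t
    proof -
      have "t \<in> ball x d" using that * unfolding cbox_interval by blast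
      then show "\<bar>t - x\<bar> < d" by (simp add: dist_real_def abs_minus_commute)
      show "dist (of_real t) (of_real x :: complex) = \<bar>t - x\<bar>"
        by (metis dist_norm norm_of_real of_real_diff)
    qed (use that in auto)
    have "?F integrable_on ({u..v} - {x})"
    proof (rule measurable_bounded_by_integrable_imp_integrable_real)
      have "continuous_on ({u..v} - {x}) ?F"
        by (intro continuous_intros continuous_on_compose2[OF holomorphic_on_imp_continuous_on[OF d2(2)]])
          (use near in \<open>force simp: d_def dist_commute\<close>)
      then show "?F \<in> borel_measurable (lebesgue_on ({u..v} - {x}))"
        by (rule continuous_imp_measurable_on_sets_lebesgue) auto
      have "(\<lambda>t. ln C + 2 * real n * inverse (sqrt \<bar>t - x\<bar>)) integrable_on {u..v}"
        by (intro integrable_add integrable_on_mult_right integrable_inverse_sqrt_abs) auto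
      then show "(\<lambda>t. ln C + 2 * real n * inverse (sqrt \<bar>t - x\<bar>)) integrable_on ({u..v} - {x})"
        by (rule integrable_spike_set) (auto intro: negligible_subset[of "{x}"])
      fix t assume t: "t \<in> {u..v} - {x}"
      have "norm (h (of_real t)) \<le> C / \<bar>t - x\<bar> ^ n"
        using d1(2)[of "of_real t"] near[OF t] by (simp add: d_def dist_norm)
      then show "\<bar>?F t\<bar> \<le> ln C + 2 * real n * inverse (sqrt \<bar>t - x\<bar>)"
        using t near(3)[OF t] C by (simp add: log_plus_pole_bound d_def)
    qed auto
    then show "?F integrable_on cbox u v"
      unfolding cbox_interval
      by (rule integrable_spike_set) (auto intro: negligible_subset[of "{x}"])
  qed
qed

lemma integrable_log_plus_meromorphic_circle:
  assumes f: "f meromorphic_on UNIV"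
  shows "(\<lambda>\<theta>. log_plus (norm (f (of_real r * cis \<theta>)))) integrable_on {a..b}"
proof -
  have "(\<lambda>\<zeta>. f (of_real r * exp (\<i> * \<zeta>))) meromorphic_on UNIV"
    by (rule meromorphic_on_compose[OF f]) (auto intro!: analytic_intros)
  from integrable_log_plus_meromorphic_real_line[OF this] show ?thesis
    by (simp add: cis_conv_exp)
qed

lemma log_plus_add:
  assumes "x \<ge> 0" "y \<ge> 0"
  shows "log_plus (x + y) \<le> log_plus x + log_plus y + ln 2"
proof -
  have "x + y \<le> max 1 x * max 1 y * 2"
  proof -
    have "max 1 x * 1 \<le> max 1 x * max 1 y" "1 * max 1 y \<le> max 1 x * max 1 y"
      by (intro mult_mono; simp)+
    then show ?thesis by linarith
  qed
  moreover have "1 * 1 * 1 \<le> max 1 x * max 1 y * 2" by (intro mult_mono) auto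
  ultimately have "log_plus (x + y) \<le> ln (max 1 x * max 1 y * 2)"
    unfolding log_plus_def by (subst ln_le_cancel_iff) auto
  also have "\<dots> = log_plus x + log_plus y + ln 2"
    using max.strict_coboundedI1[of 0 1 x] max.strict_coboundedI1[of 0 1 y]
    by (simp add: log_plus_def ln_mult_pos)
  finally show ?thesis .
qed

lemma circle_mean_log_plus_add:
  assumes f: "f meromorphic_on UNIV" and h: "h meromorphic_on UNIV"
  shows "circle_mean (\<lambda>z. log_plus (norm (f z + h z))) r \<le>
    circle_mean (\<lambda>z. log_plus (norm (f z))) r + circle_mean (\<lambda>z. log_plus (norm (h z))) r + ln 2"
proof -
  let ?I = "\<lambda>f. integral {0..2*pi} (\<lambda>\<theta>. log_plus (norm (f (of_real r * cis \<theta>))))"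
  have fh: "(\<lambda>z. f z + h z) meromorphic_on UNIV" by (intro meromorphic_intros f h)
  note int = integrable_log_plus_meromorphic_circle
  have "?I (\<lambda>z. f z + h z) \<le> integral {0..2*pi} (\<lambda>\<theta>. (log_plus (norm (f (of_real r * cis \<theta>))) +
          log_plus (norm (h (of_real r * cis \<theta>)))) + ln 2)"
    by (intro integral_le int[OF fh] integrable_add int[OF f] int[OF h]
          order_trans[OF log_plus_mono[OF norm_triangle_ineq] log_plus_add]) auto
  also have "\<dots> = ?I f + ?I h + 2 * pi * ln 2"
    by (rule integral_unique, rule has_integral_eq_rhs[OF has_integral_add[OF has_integral_add[OF
          integrable_integral[OF int[OF f]] integrable_integral[OF int[OF h]]] has_integral_const_real]])
      simp
  finally show ?thesis by (simp add: circle_mean_def field_simps)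
qed

section \<open>Pole orders and the counting function\<close>

definition pole_order :: "(complex \<Rightarrow> complex) \<Rightarrow> complex \<Rightarrow> int" where
  "pole_order f z = (if is_pole f z then - zorder f z else 0)"

text \<open>The zero expansion is covered as well, its subdegree being 0 by convention.\<close>

lemma pole_order_laurent:
  assumes "(\<lambda>w. f (z + w)) has_laurent_expansion F"
  shows "pole_order f z = max 0 (- fls_subdegree F)"
proof (cases "fls_subdegree F < 0")
  case True
  then have "F \<noteq> 0" by auto
  then show ?thesis
    using True is_pole_fls_subdegree_iff[OF assms] has_laurent_expansion_zorder[OF assms]
    by (simp add: pole_order_def)
qed (use is_pole_fls_subdegree_iff[OF assms] in \<open>auto simp: pole_order_def\<close>)

lemma pole_order_nonneg:
  assumes "f meromorphic_on UNIV"
  shows "0 \<le> pole_order f z"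
  using assms pole_order_laurent unfolding meromorphic_on_def by (metis UNIV_I max.cobounded1)

lemma pole_order_add:
  assumes f: "f meromorphic_on UNIV" and h: "h meromorphic_on UNIV"
  shows "pole_order (\<lambda>z. f z + h z) z \<le> pole_order f z + pole_order h z"
proof -
  obtain F H where F: "(\<lambda>w. f (z + w)) has_laurent_expansion F"
    and H: "(\<lambda>w. h (z + w)) has_laurent_expansion H"
    using f h unfolding meromorphic_on_def by (metis UNIV_I)
  have FH: "(\<lambda>w. f (z + w) + h (z + w)) has_laurent_expansion F + H"
    by (intro laurent_expansion_intros F H)
  have "max 0 (- fls_subdegree (F + H)) \<le> max 0 (- fls_subdegree F) + max 0 (- fls_subdegree H)"
    using fls_plus_subdegree[of F H] by (cases "F + H = 0") auto
  then show ?thesis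
    using pole_order_laurent[OF F] pole_order_laurent[OF H] pole_order_laurent[of "\<lambda>z. f z + h z", OF FH]
    by simp
qed

lemma finite_poles:
  assumes "f meromorphic_on UNIV"
  shows "finite {z. norm z \<le> r \<and> is_pole f z}"
proof -
  have "{z. is_pole f z} sparse_in UNIV"
    using meromorphic_on_imp_not_pole_cosparse[OF assms] by (simp add: eventually_cosparse)
  then have "{z. is_pole f z} sparse_in cball 0 r" by (rule sparse_in_subset) auto
  then have "finite (cball 0 r \<inter> {z. is_pole f z})" by (rule sparse_in_compact_finite) auto
  then show ?thesis by (rule rev_finite_subset) auto
qed

text \<open>The contribution of a simple pole at z to the counting function at radius r. At the
  origin it is negative for r < 1, so nonnegativity is claimed from r = 1 on.\<close>

definition log_weight :: "real \<Rightarrow> complex \<Rightarrow> real" where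
  "log_weight r z = (if z = 0 then ln r else if norm z \<le> r then ln (r / norm z) else 0)"

lemma log_weight_nonneg: "1 \<le> r \<Longrightarrow> 0 \<le> log_weight r z"
  by (auto simp: log_weight_def)

text \<open>Any finite S containing the poles in the disc will do, because \<open>pole_order\<close>
  vanishes elsewhere; so one S can serve f, h and their sum at once.\<close>

lemma pole_count_eq:
  assumes S: "finite S" "\<And>z. norm z \<le> r \<Longrightarrow> is_pole f z \<Longrightarrow> z \<in> S" and t: "t \<le> r"
  shows "pole_count f t = (\<Sum>z\<in>S. if norm z \<le> t then of_int (pole_order f z) else 0)"
  unfolding pole_count_def
  by (rule sum.mono_neutral_cong_left) (use assms in \<open>auto simp: pole_order_def split: if_splits\<close>)

lemma has_integral_step_over_id:
  fixes a r :: real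
  assumes "0 < a" "0 < r"
  shows "((\<lambda>t. if a \<le> t then 1 / t else 0) has_integral (if a \<le> r then ln (r / a) else 0)) {0..r}"
proof (cases "a \<le> r")
  case True
  have "((\<lambda>t. 1 / t) has_integral (ln r - ln a)) {a..r}"
    by (rule fundamental_theorem_of_calculus[OF True])
      (use assms in \<open>auto intro!: derivative_eq_intros simp flip: has_real_derivative_iff_has_vector_derivative\<close>)
  then have "((\<lambda>t. if t \<in> {a..r} then 1 / t else 0) has_integral (ln r - ln a)) {0..r}"
    using assms by (subst has_integral_restrict) auto
  then have "((\<lambda>t. if a \<le> t then 1 / t else 0) has_integral (ln r - ln a)) {0..r}"
    by (rule has_integral_eq[rotated]) auto
  then show ?thesis using True assms by (simp add: ln_div)
qed (auto intro!: has_integral_is_0)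

text \<open>A pole z other than 0 enters the integrand as a step at radius \<open>norm z\<close>,
  divided by t. A pole at the origin cancels in the integrand and returns through the term with
  \<open>ln r\<close>.\<close>

lemma counting_fun_eq:
  assumes S: "finite S" "\<And>z. norm z \<le> r \<Longrightarrow> is_pole f z \<Longrightarrow> z \<in> S" and r: "0 < r"
  shows "counting_fun f r = (\<Sum>z\<in>S. of_int (pole_order f z) * log_weight r z)"
proof -
  define w where "w z t = (if norm z \<le> t then 1 / t else 0)" for z :: complex and t :: real
  have 0: "pole_count f 0 = of_int (pole_order f 0)"
  proof -
    have "pole_count f 0 = (\<Sum>z\<in>insert 0 S. if norm z \<le> 0 then of_int (pole_order f z) else 0)"
      by (rule pole_count_eq[of _ r]) (use S r in auto)
    also have "\<dots> = (\<Sum>z\<in>insert 0 S. if z = 0 then of_int (pole_order f 0) else 0)"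
      by (rule sum.cong) auto
    also have "\<dots> = of_int (pole_order f 0)" using S(1) by (subst sum.delta) auto
    finally show ?thesis .
  qed
  have "((\<lambda>t. \<Sum>z\<in>S - {0}. of_int (pole_order f z) * w z t) has_integral
         (\<Sum>z\<in>S - {0}. of_int (pole_order f z) * log_weight r z)) {0..r}"
  proof (intro has_integral_sum has_integral_mult_right)
    fix z assume "z \<in> S - {0}"
    then show "(w z has_integral log_weight r z) {0..r}"
      using has_integral_step_over_id[of "norm z" r] r by (simp add: w_def[abs_def] log_weight_def)
  qed (use S in auto)
  moreover have "(pole_count f t - pole_count f 0) / t = (\<Sum>z\<in>S - {0}. of_int (pole_order f z) * w z t)"
    if t: "t \<in> {0..r}" for t
  proof -
    have "pole_count f t = (\<Sum>z\<in>insert 0 S. if norm z \<le> t then of_int (pole_order f z) else 0)"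
      by (rule pole_count_eq[of _ r]) (use S t in auto)
    also have "\<dots> = of_int (pole_order f 0) + (\<Sum>z\<in>S - {0}. if norm z \<le> t then of_int (pole_order f z) else 0)"
      using S t by (subst sum.insert_remove) auto
    finally show ?thesis
      by (auto simp: 0 sum_divide_distrib w_def intro!: sum.cong split: if_splits)
  qed
  ultimately have "integral {0..r} (\<lambda>t. (pole_count f t - pole_count f 0) / t) =
     (\<Sum>z\<in>S - {0}. of_int (pole_order f z) * log_weight r z)"
    by (metis (no_types, lifting) has_integral_cong integral_unique)
  then have "counting_fun f r = (\<Sum>z\<in>insert 0 S. of_int (pole_order f z) * log_weight r z)"
    using S by (simp add: counting_fun_def 0 log_weight_def sum.insert_remove)
  also have "\<dots> = (\<Sum>z\<in>S. of_int (pole_order f z) * log_weight r z)"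
    using S(2)[of 0] S(1) r by (cases "0 \<in> S") (auto simp: insert_absorb pole_order_def)
  finally show ?thesis .
qed

lemma counting_fun_add:
  assumes f: "f meromorphic_on UNIV" and h: "h meromorphic_on UNIV" and r: "1 \<le> r"
  shows "counting_fun (\<lambda>z. f z + h z) r \<le> counting_fun f r + counting_fun h r"
proof -
  define S where "S = {z. norm z \<le> r \<and> is_pole f z} \<union> {z. norm z \<le> r \<and> is_pole h z} \<union>
      {z. norm z \<le> r \<and> is_pole (\<lambda>z. f z + h z) z}"
  have S: "finite S" unfolding S_def by (intro finite_UnI finite_poles meromorphic_intros f h)
  have "counting_fun (\<lambda>z. f z + h z) r = (\<Sum>z\<in>S. of_int (pole_order (\<lambda>z. f z + h z) z) * log_weight r z)"
    by (rule counting_fun_eq[OF S]) (use r in \<open>auto simp: S_def\<close>)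
  also have "\<dots> \<le> (\<Sum>z\<in>S. of_int (pole_order f z + pole_order h z) * log_weight r z)"
    using log_weight_nonneg[OF r] pole_order_add[OF f h] by (intro sum_mono mult_right_mono of_int_le_iff[THEN iffD2])
  also have "\<dots> = (\<Sum>z\<in>S. of_int (pole_order f z) * log_weight r z) + (\<Sum>z\<in>S. of_int (pole_order h z) * log_weight r z)"
    by (simp add: sum.distrib algebra_simps)
  also have "\<dots> = counting_fun f r + counting_fun h r"
    by (intro arg_cong2[where f = "(+)"] counting_fun_eq[symmetric] S) (use r in \<open>auto simp: S_def\<close>)
  finally show ?thesis .
qed

lemma nevanlinna_char_add:
  assumes "f meromorphic_on UNIV" "h meromorphic_on UNIV" "1 \<le> r"
  shows "nevanlinna_char (\<lambda>z. f z + h z) r \<le> nevanlinna_char f r + nevanlinna_char h r + ln 2"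
  using circle_mean_log_plus_add[OF assms(1,2), of r] counting_fun_add[OF assms]
  by (simp add: nevanlinna_char_eq)

lemma nevanlinna_char_cmult:
  assumes "norm c = 1"
  shows "nevanlinna_char (\<lambda>z. c * f z) = nevanlinna_char f"
proof -
  have "c \<noteq> 0" using assms by auto
  then show ?thesis
    using assms by (simp add: nevanlinna_char_eq[abs_def] counting_fun_def pole_count_def norm_mult zorder_cmult)
qed

lemma finite_circle_preimage:
  assumes "finite B" "0 < r"
  shows "finite {\<theta>\<in>{0..2 * pi}. of_real r * cis \<theta> \<in> B}"
proof -
  have "{\<theta>\<in>{0..2 * pi}. of_real r * cis \<theta> \<in> B} \<subseteq> insert (2 * pi) (Arg2pi ` B)"
  proof safe
    fix \<theta> assume *: "\<theta> \<in> {0..2 * pi}" "of_real r * cis \<theta> \<in> B" "\<theta> \<notin> Arg2pi ` B"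
    have "\<theta> = Arg2pi (of_real r * cis \<theta>)" if "\<theta> < 2 * pi"
      using Arg2pi_unique[of r \<theta> "of_real r * cis \<theta>"] assms * that by (simp add: cis_conv_exp)
    then show "\<theta> = 2 * pi" using * by (cases "\<theta> < 2 * pi") auto
  qed
  then show ?thesis by (rule finite_subset) (use assms in auto)
qed

text \<open>Without poles, f differs from an entire function only on a discrete set, which meets the
  circle in finitely many points that the integral ignores.\<close>

lemma nevanlinna_char_remove_sings:
  assumes f: "f meromorphic_on UNIV" and no: "\<And>z. \<not> is_pole f z" and r: "0 < r"
  shows "remove_sings f holomorphic_on UNIV"
    and "nevanlinna_char f r = nevanlinna_char (remove_sings f) r"
proof -
  have "remove_sings f analytic_on {z}" for z
  proof -
    have "f meromorphic_on {z}" using f by (rule meromorphic_on_subset) simp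
    then show ?thesis using no[of z] remove_sings_analytic_at[of f z]
      by (auto simp: meromorphic_at_iff not_essential_def)
  qed
  then show hol: "remove_sings f holomorphic_on UNIV"
    using analytic_on_analytic_at analytic_on_open by blast
  have "{z. remove_sings f z \<noteq> f z} sparse_in UNIV"
    using eventually_remove_sings_eq[OF f] by (simp add: eventually_cosparse)
  then have "{z. remove_sings f z \<noteq> f z} sparse_in sphere 0 r" by (rule sparse_in_subset) auto
  then have fin: "finite (sphere 0 r \<inter> {z. remove_sings f z \<noteq> f z})" by (rule sparse_in_compact_finite) auto
  have "circle_mean (\<lambda>z. log_plus (norm (f z))) r = circle_mean (\<lambda>z. log_plus (norm (remove_sings f z))) r"
    unfolding circle_mean_def
    by (intro arg_cong2[where f = "(*)"] refl integral_spike[OF negligible_finite[OF finite_circle_preimage[OF fin r]]])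
      (use r in \<open>auto simp: norm_mult\<close>)
  then show "nevanlinna_char f r = nevanlinna_char (remove_sings f) r"
    using no entire_no_poles[OF hol] by (simp add: nevanlinna_char_no_poles)
qed

text \<open>A single pole already contributes a logarithm to the counting function. Without poles f
  is entire up to a discrete set, and bounded growth leaves only constants.\<close>

lemma nevanlinna_char_at_top_or_const:
  assumes f: "f meromorphic_on UNIV"
  shows "filterlim (nevanlinna_char f) at_top at_top \<or> (\<exists>c. \<forall>r>0. nevanlinna_char f r = c)"
proof (cases "\<exists>a. is_pole f a")
  case True
  then obtain a where a: "is_pole f a" by blast
  have "f meromorphic_on {a}" using f by (rule meromorphic_on_subset) simp
  then have ord: "1 \<le> pole_order f a"
    using isolated_pole_imp_neg_zorder[of f a] a by (simp add: pole_order_def meromorphic_at_iff)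
  have "\<forall>\<^sub>F r in at_top. log_weight r a \<le> nevanlinna_char f r"
    using eventually_ge_at_top[of 1] eventually_ge_at_top[of "norm a"]
  proof eventually_elim
    case (elim r)
    let ?S = "{z. norm z \<le> r \<and> is_pole f z}"
    have "log_weight r a \<le> of_int (pole_order f a) * log_weight r a"
      using mult_right_mono[of 1 "of_int (pole_order f a)" "log_weight r a"] ord log_weight_nonneg[OF elim(1)] by simp
    also have "\<dots> \<le> (\<Sum>z\<in>?S. of_int (pole_order f z) * log_weight r z)"
      using a elim log_weight_nonneg[OF elim(1)] pole_order_nonneg[OF f]
      by (intro member_le_sum finite_poles[OF f]) auto
    also have "\<dots> = counting_fun f r"
      by (rule counting_fun_eq[symmetric, OF finite_poles[OF f]]) (use elim in auto)
    also have "\<dots> \<le> nevanlinna_char f r"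
      by (simp add: nevanlinna_char_eq circle_mean_nonneg)
    finally show ?case .
  qed
  moreover have "filterlim (\<lambda>r. log_weight r a) at_top at_top"
  proof (cases "a = 0")
    case True
    then show ?thesis by (simp add: log_weight_def ln_at_top)
  next
    case False
    then have "norm a > 0" by simp
    then have "filterlim (\<lambda>r. ln (r / norm a)) at_top at_top" by real_asymp
    moreover have "\<forall>\<^sub>F r in at_top. log_weight r a = ln (r / norm a)"
      using eventually_ge_at_top[of "norm a"] by eventually_elim (simp add: log_weight_def False)
    ultimately show ?thesis by (simp add: filterlim_cong)
  qed
  ultimately show ?thesis by (blast intro: filterlim_at_top_mono)
next
  case False
  then have no: "\<not> is_pole f z" for z by blast
  note eq = nevanlinna_char_remove_sings(2)[OF f no]
  have hol: "remove_sings f holomorphic_on UNIV"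
    by (rule nevanlinna_char_remove_sings(1)[OF f no, of 1]) simp
  show ?thesis
  proof (cases "remove_sings f constant_on UNIV")
    case True
    then obtain c where "\<And>z. remove_sings f z = c" by (auto simp: constant_on_def)
    then have "nevanlinna_char f r = log_plus (norm c)" if "r > 0" for r
      using eq[OF that] by (simp add: nevanlinna_char_no_poles[OF entire_no_poles[OF hol]] circle_mean_def)
    then show ?thesis by blast
  next
    case False
    then have "filterlim (nevanlinna_char (remove_sings f)) at_top at_top"
      using hol by (intro nevanlinna_char_at_top) (simp add: nonconst_entire_def)
    moreover have "\<forall>\<^sub>F r in at_top. nevanlinna_char f r = nevanlinna_char (remove_sings f) r"
      using eventually_gt_at_top[of 0] by eventually_elim (rule eq)
    ultimately show ?thesis by (simp add: filterlim_cong)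
  qed
qed

section \<open>Growth ratios and iterated logarithms\<close>

lemma filterlim_funpow_at_top:
  fixes h :: "real \<Rightarrow> real"
  assumes "filterlim h at_top at_top"
  shows "filterlim (h ^^ n) at_top at_top"
proof (induction n)
  case (Suc n)
  then show ?case using filterlim_compose[OF assms Suc] by (simp add: o_def)
qed (simp add: filterlim_ident)

lemma eventually_funpow_exp_ln: "\<forall>\<^sub>F x in at_top. (exp ^^ n) ((ln ^^ n) x) = (x::real)"
proof (induction n)
  case (Suc n)
  have "\<forall>\<^sub>F x in at_top. (exp ^^ n) ((ln ^^ n) (ln x)) = (ln x :: real)"
    by (rule eventually_compose_filterlim[OF Suc ln_at_top])
  then show ?case using eventually_gt_at_top[of 0]
  proof eventually_elim
    case (elim x)
    have "(exp ^^ Suc n) ((ln ^^ Suc n) x) = exp ((exp ^^ n) ((ln ^^ n) (ln x)))"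
      by (simp add: funpow_swap1)
    then show ?case using elim by simp
  qed
qed simp

lemma strict_mono_funpow_exp: "strict_mono (exp ^^ n :: real \<Rightarrow> real)"
  by (induction n) (auto simp: strict_mono_def)

lemma funpow_exp_pos: "n \<ge> 1 \<Longrightarrow> 0 < (exp ^^ n) (x::real)"
  by (cases n) auto

lemma funpow_exp_ge: "x \<le> (exp ^^ n) (x::real)"
proof (induction n)
  case (Suc n)
  have "(exp ^^ n) x \<le> exp ((exp ^^ n) x)"
    using exp_ge_add_one_self[of "(exp ^^ n) x"] by linarith
  with Suc show ?case by simp
qed simp

lemma funpow_exp_scale:
  fixes \<sigma> x :: real
  assumes "1 \<le> \<sigma>" "1 \<le> x"
  shows "\<sigma> * (exp ^^ n) x \<le> (exp ^^ n) (\<sigma> * x)"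
proof (induction n)
  case (Suc n)
  let ?y = "(exp ^^ n) x"
  have "1 \<le> ?y" using funpow_exp_ge[of x n] assms by linarith
  have "\<sigma> * exp ?y \<le> exp (\<sigma> - 1) * exp ?y"
    using exp_ge_add_one_self[of "\<sigma> - 1"] by (intro mult_right_mono) auto
  also have "\<dots> \<le> exp (\<sigma> * ?y)"
    using mult_left_mono[OF \<open>1 \<le> ?y\<close>, of "\<sigma> - 1"] assms by (simp add: algebra_simps flip: exp_add)
  also have "\<dots> \<le> exp ((exp ^^ n) (\<sigma> * x))" using Suc by simp
  finally show ?case by simp
qed simp

text \<open>The power acts on the outermost exponential, which exists because n is at least 1, and
  multiplies its exponent by d / c; the inner iterates only enlarge such a factor. Thus a gap
  between orders c < d becomes a power of the radius.\<close>

lemma funpow_exp_powr_le: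
  fixes c d x :: real
  assumes "n \<ge> 1" "0 < c" "c \<le> d" "1 \<le> c * x"
  shows "(exp ^^ n) (c * x) powr (d / c) \<le> (exp ^^ n) (d * x)"
proof -
  obtain k where k: "n = Suc k" using assms(1) by (cases n) auto
  have "d / c * (exp ^^ k) (c * x) \<le> (exp ^^ k) (d / c * (c * x))"
    using assms by (intro funpow_exp_scale) auto
  then show ?thesis using assms by (simp add: k powr_def)
qed

lemma filterlim_funpow_exp_scale:
  assumes "0 < (c::real)"
  shows "filterlim (\<lambda>x. (exp ^^ n) (c * x)) at_top at_top"
  by (rule filterlim_compose[OF filterlim_funpow_at_top[OF exp_at_top]]) (use assms in real_asymp)

lemma nevanlinna_char_funpow_exp_contract:
  assumes g: "nonconst_entire g" and n: "n \<ge> 1" and cd: "0 < c" "c < d"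
  obtains \<kappa> where "0 \<le> \<kappa>" "\<kappa> < 1"
    "\<forall>\<^sub>F x in at_top. nevanlinna_char g ((exp ^^ n) (c * x)) \<le> \<kappa> * nevanlinna_char g ((exp ^^ n) (d * x))"
proof -
  have hol: "g holomorphic_on UNIV" using g by (simp add: nonconst_entire_def)
  have "1 < d / c" using cd by simp
  from nevanlinna_char_powr_gt1[OF g this] obtain \<kappa> where \<kappa>: "\<kappa> < 1"
    "\<forall>\<^sub>F R in at_top. nevanlinna_char g R \<le> \<kappa> * nevanlinna_char g (R powr (d / c))" by blast
  from eventually_compose_filterlim[OF \<kappa>(2) filterlim_funpow_exp_scale[OF cd(1), of n]]
  have "\<forall>\<^sub>F x in at_top. nevanlinna_char g ((exp ^^ n) (c * x)) \<le> max 0 \<kappa> * nevanlinna_char g ((exp ^^ n) (d * x))"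
    using eventually_ge_at_top[of "1 / c"]
  proof eventually_elim
    case (elim x)
    let ?R = "(exp ^^ n) (c * x)"
    have "nevanlinna_char g ?R \<le> max 0 \<kappa> * nevanlinna_char g (?R powr (d / c))"
      using nevanlinna_char_nonneg[OF hol]
      by (intro order_trans[OF elim(1)] mult_right_mono) auto
    also have "\<dots> \<le> max 0 \<kappa> * nevanlinna_char g ((exp ^^ n) (d * x))"
      using elim cd by (intro mult_left_mono nevanlinna_char_mono[OF hol] funpow_exp_powr_le n)
        (auto simp: field_simps)
    finally show ?case .
  qed
  then show ?thesis using \<kappa>(1) by (intro that[of "max 0 \<kappa>"]) auto
qed

lemma nevanlinna_char_funpow_exp_property_A:
  assumes A: "property_A g" and n: "n \<ge> 1" and cd: "0 < c" "c < d"
  shows "\<forall>\<^sub>F x in at_top. K * nevanlinna_char g ((exp ^^ n) (c * x)) \<le> nevanlinna_char g ((exp ^^ n) (d * x))"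
proof -
  have hol: "g holomorphic_on UNIV" using A by (simp add: property_A_def nonconst_entire_def)
  have "1 < d / c" using cd by simp
  from eventually_compose_filterlim[OF nevanlinna_char_powr_property_A[OF A this, of K]
      filterlim_funpow_exp_scale[OF cd(1), of n]]
  show ?thesis using eventually_ge_at_top[of "1 / c"]
  proof eventually_elim
    case (elim x)
    then show ?case using cd
      by (intro order_trans[OF elim(1)] nevanlinna_char_mono[OF hol] funpow_exp_powr_le n) (auto simp: field_simps)
  qed
qed

text \<open>With w = u + c v and c * c = 1, the summands are recovered as u = w - c v and v = c w -
  c u, and factors of modulus 1 do not change the characteristic.\<close>

lemma nevanlinna_char_signed_sum:
  assumes u: "u meromorphic_on UNIV" and v: "v meromorphic_on UNIV" and c: "c \<in> {1, -1}" and r: "1 \<le> r"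
  shows "nevanlinna_char (\<lambda>z. u z + c * v z) r \<le> nevanlinna_char u r + nevanlinna_char v r + ln 2"
    and "nevanlinna_char u r \<le> nevanlinna_char (\<lambda>z. u z + c * v z) r + nevanlinna_char v r + ln 2"
    and "nevanlinna_char v r \<le> nevanlinna_char (\<lambda>z. u z + c * v z) r + nevanlinna_char u r + ln 2"
proof -
  let ?w = "\<lambda>z. u z + c * v z"
  have cc: "norm c = 1" "norm (- c) = 1" "c * c = 1" using c by auto
  have w: "?w meromorphic_on UNIV" by (intro meromorphic_intros u v)
  show "nevanlinna_char ?w r \<le> nevanlinna_char u r + nevanlinna_char v r + ln 2"
    using nevanlinna_char_add[OF u _ r, of "\<lambda>z. c * v z"] v
    by (simp add: nevanlinna_char_cmult[OF cc(1)] meromorphic_intros)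
  have cv: "(\<lambda>z. - c * v z) meromorphic_on UNIV" and cu: "(\<lambda>z. - c * u z) meromorphic_on UNIV"
    and cw: "(\<lambda>z. c * ?w z) meromorphic_on UNIV"
    by (intro meromorphic_intros u v w)+
  have "(\<lambda>z. ?w z + - c * v z) = u" by simp
  with nevanlinna_char_add[OF w cv r]
  show "nevanlinna_char u r \<le> nevanlinna_char ?w r + nevanlinna_char v r + ln 2"
    by (simp only: nevanlinna_char_cmult[OF cc(2)])
  have "(\<lambda>z. c * ?w z + - c * u z) = v"
    using cc(3) by (simp add: distrib_left mult.assoc[symmetric])
  with nevanlinna_char_add[OF cw cu r]
  show "nevanlinna_char v r \<le> nevanlinna_char ?w r + nevanlinna_char u r + ln 2"
    by (simp only: nevanlinna_char_cmult[OF cc(1)] nevanlinna_char_cmult[OF cc(2)])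
qed

section \<open>Relative orders as comparisons of characteristics at a common radius\<close>

context
  fixes p q :: nat and \<phi> :: "real \<Rightarrow> real"
  assumes p: "1 \<le> p" and \<phi>: "filterlim \<phi> at_top at_top"
begin

definition iter_log_scale :: "real \<Rightarrow> real" where "iter_log_scale r = (ln ^^ q) (\<phi> r)"

lemma iter_log_scale_at_top: "filterlim iter_log_scale at_top at_top"
  unfolding iter_log_scale_def[abs_def] by (rule filterlim_compose[OF filterlim_funpow_at_top[OF ln_at_top] \<phi>])

abbreviation level :: "(complex \<Rightarrow> complex) \<Rightarrow> real \<Rightarrow> real \<Rightarrow> real" where
  "level g c r \<equiv> nevanlinna_char g ((exp ^^ p) (c * iter_log_scale r))"

text \<open>The quantifier over c stands inside: how large r must be depends on f and g
  only.\<close>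

lemma growth_ratio_le_iff:
  assumes f: "filterlim (nevanlinna_char f) at_top at_top" and g: "nonconst_entire g"
  shows "\<forall>\<^sub>F r in at_top. \<forall>c. growth_ratio p q \<phi> g f r \<le> c \<longleftrightarrow> nevanlinna_char f r \<le> level g c r"
proof -
  have inv: "filterlim (\<lambda>r. nevanlinna_char_inv g (nevanlinna_char f r)) at_top at_top"
    by (rule filterlim_compose[OF nevanlinna_char_inv_at_top[OF g] f])
  have "\<forall>\<^sub>F r in at_top. 0 < iter_log_scale r"
    using iter_log_scale_at_top by (auto simp: filterlim_at_top_dense)
  moreover have "\<forall>\<^sub>F r in at_top. nevanlinna_char g 1 < nevanlinna_char f r"
    using f by (auto simp: filterlim_at_top_dense)
  ultimately show ?thesis using eventually_compose_filterlim[OF eventually_funpow_exp_ln[of p] inv]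
  proof eventually_elim
    case (elim r)
    let ?h = "nevanlinna_char_inv g (nevanlinna_char f r)"
    show ?case
    proof
      fix c
      have "growth_ratio p q \<phi> g f r \<le> c \<longleftrightarrow> (ln ^^ p) ?h \<le> c * iter_log_scale r"
        using elim(1) by (simp add: growth_ratio_def iter_log_scale_def pos_divide_le_eq)
      also have "\<dots> \<longleftrightarrow> (exp ^^ p) ((ln ^^ p) ?h) \<le> (exp ^^ p) (c * iter_log_scale r)"
        by (simp add: strict_mono_less_eq[OF strict_mono_funpow_exp])
      also have "\<dots> \<longleftrightarrow> nevanlinna_char f r \<le> level g c r"
        unfolding elim(3) by (rule nevanlinna_char_inv_le_iff[OF g elim(2) funpow_exp_pos[OF p]])
      finally show "growth_ratio p q \<phi> g f r \<le> c \<longleftrightarrow> nevanlinna_char f r \<le> level g c r" .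
    qed
  qed
qed

lemma rel_order_nonneg:
  assumes f: "filterlim (nevanlinna_char f) at_top at_top" and g: "nonconst_entire g"
  shows "0 \<le> rel_order p q \<phi> g f"
proof -
  have "filterlim (\<lambda>r. (ln ^^ p) (nevanlinna_char_inv g (nevanlinna_char f r))) at_top at_top"
    by (intro filterlim_compose[OF filterlim_funpow_at_top[OF ln_at_top]]
          filterlim_compose[OF nevanlinna_char_inv_at_top[OF g] f])
  then have "\<forall>\<^sub>F r in at_top. 0 \<le> (ln ^^ p) (nevanlinna_char_inv g (nevanlinna_char f r))"
    by (auto simp: filterlim_at_top)
  moreover have "\<forall>\<^sub>F r in at_top. 0 \<le> iter_log_scale r"
    using iter_log_scale_at_top by (auto simp: filterlim_at_top)
  ultimately have "\<forall>\<^sub>F r in at_top. 0 \<le> ereal (growth_ratio p q \<phi> g f r)"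
    by eventually_elim (simp add: growth_ratio_def iter_log_scale_def)
  then show ?thesis unfolding rel_order_def by (intro le_Limsup) auto
qed

text \<open>If the characteristic were constant, the numerator of the ratio would be one fixed
  number, whatever the inverse returns, and the order would be 0.\<close>

lemma nevanlinna_char_at_top_of_rel_order:
  assumes f: "f meromorphic_on UNIV" and "nonzero_finite (rel_order p q \<phi> g f)"
  shows "filterlim (nevanlinna_char f) at_top at_top"
proof (rule ccontr)
  assume "\<not> ?thesis"
  then obtain c where c: "\<And>r. r > 0 \<Longrightarrow> nevanlinna_char f r = c"
    using nevanlinna_char_at_top_or_const[OF f] by blast
  let ?k = "(ln ^^ p) (nevanlinna_char_inv g c)"
  have "((\<lambda>r. ?k / iter_log_scale r) \<longlongrightarrow> 0) at_top"
    by (rule real_tendsto_divide_at_top[OF tendsto_const iter_log_scale_at_top])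
  moreover have "\<forall>\<^sub>F r in at_top. ?k / iter_log_scale r = growth_ratio p q \<phi> g f r"
    using eventually_gt_at_top[of 0] by eventually_elim (simp add: growth_ratio_def iter_log_scale_def c)
  ultimately have "(growth_ratio p q \<phi> g f \<longlongrightarrow> 0) at_top"
    by (rule Lim_transform_eventually)
  then have "((\<lambda>r. ereal (growth_ratio p q \<phi> g f r)) \<longlongrightarrow> ereal 0) at_top" by simp
  then have "rel_order p q \<phi> g f = 0"
    unfolding rel_order_def by (subst lim_imp_Limsup) (auto simp: zero_ereal_def)
  then show False using assms by (simp add: nonzero_finite_def)
qed

lemma rel_order_pos_real:
  assumes f: "f meromorphic_on UNIV" and g: "nonconst_entire g" and nf: "nonzero_finite (rel_order p q \<phi> g f)"
  obtains \<rho> where "0 < \<rho>" "rel_order p q \<phi> g f = ereal \<rho>"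
proof -
  have "0 \<le> rel_order p q \<phi> g f"
    by (rule rel_order_nonneg[OF nevanlinna_char_at_top_of_rel_order[OF f nf] g])
  with nf that show ?thesis
    by (cases "rel_order p q \<phi> g f") (auto simp: nonzero_finite_def)
qed

lemma eventually_le_level:
  assumes "filterlim (nevanlinna_char f) at_top at_top" "nonconst_entire g" "rel_order p q \<phi> g f < ereal c"
  shows "\<forall>\<^sub>F r in at_top. nevanlinna_char f r \<le> level g c r"
  using Limsup_lessD[OF assms(3)[unfolded rel_order_def]] growth_ratio_le_iff[OF assms(1,2)]
  by eventually_elim (auto dest: less_imp_le)

lemma eventually_level_less:
  assumes "filterlim (nevanlinna_char f) at_top at_top" "nonconst_entire g" "ereal c < rel_lower_order p q \<phi> g f"
  shows "\<forall>\<^sub>F r in at_top. level g c r < nevanlinna_char f r"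
  using less_LiminfD[OF assms(3)[unfolded rel_lower_order_def]] growth_ratio_le_iff[OF assms(1,2)]
  by eventually_elim (metis ereal_less_eq(3) not_le)

lemma frequently_level_less:
  assumes "filterlim (nevanlinna_char f) at_top at_top" "nonconst_entire g" "ereal c < rel_order p q \<phi> g f"
  shows "\<exists>\<^sub>F r in at_top. level g c r < nevanlinna_char f r"
proof -
  have "\<exists>\<^sub>F r in at_top. c < growth_ratio p q \<phi> g f r"
  proof (rule ccontr)
    assume "\<not> ?thesis"
    then have "\<forall>\<^sub>F r in at_top. ereal (growth_ratio p q \<phi> g f r) \<le> ereal c"
      by (simp add: not_frequently not_less)
    then have "rel_order p q \<phi> g f \<le> ereal c"
      unfolding rel_order_def by (rule Limsup_bounded)
    with assms(3) show False by simp
  qed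
  moreover have "\<forall>\<^sub>F r in at_top. c < growth_ratio p q \<phi> g f r \<longrightarrow> level g c r < nevanlinna_char f r"
    using growth_ratio_le_iff[OF assms(1,2)] by eventually_elim (metis not_le)
  ultimately show ?thesis by (rule frequently_mp[rotated])
qed

lemma level_at_top:
  assumes "nonconst_entire g" "0 < c"
  shows "filterlim (level g c) at_top at_top"
  by (rule filterlim_compose[OF nevanlinna_char_at_top[OF assms(1)]
        filterlim_compose[OF filterlim_funpow_exp_scale[OF assms(2)] iter_log_scale_at_top]])

lemma level_mono:
  assumes g: "nonconst_entire g" and "c \<le> d"
  shows "\<forall>\<^sub>F r in at_top. level g c r \<le> level g d r"
proof -
  have hol: "g holomorphic_on UNIV" using g by (simp add: nonconst_entire_def)
  have "\<forall>\<^sub>F r in at_top. 0 \<le> iter_log_scale r" using iter_log_scale_at_top by (auto simp: filterlim_at_top)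
  then show ?thesis
  proof eventually_elim
    case (elim r)
    then have "(exp ^^ p) (c * iter_log_scale r) \<le> (exp ^^ p) (d * iter_log_scale r)"
      using assms by (simp add: strict_mono_less_eq[OF strict_mono_funpow_exp] mult_right_mono)
    then show ?case using funpow_exp_pos[OF p, of "c * iter_log_scale r"]
      by (intro nevanlinna_char_mono[OF hol]) auto
  qed
qed

lemma level_contract:
  assumes "nonconst_entire g" "0 < c" "c < d"
  obtains \<kappa> where "0 \<le> \<kappa>" "\<kappa> < 1" "\<forall>\<^sub>F r in at_top. level g c r \<le> \<kappa> * level g d r"
proof -
  obtain \<kappa> where "0 \<le> \<kappa>" "\<kappa> < 1"
    "\<forall>\<^sub>F x in at_top. nevanlinna_char g ((exp ^^ p) (c * x)) \<le> \<kappa> * nevanlinna_char g ((exp ^^ p) (d * x))"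
    using nevanlinna_char_funpow_exp_contract[OF assms(1) p assms(2,3)] by blast
  then show ?thesis
    by (intro that[of \<kappa>] eventually_compose_filterlim[OF _ iter_log_scale_at_top])
qed

lemma level_property_A:
  assumes "property_A g" "0 < c" "c < d"
  shows "\<forall>\<^sub>F r in at_top. K * level g c r \<le> level g d r"
  by (rule eventually_compose_filterlim[OF nevanlinna_char_funpow_exp_property_A[OF assms(1) p assms(2,3)] iter_log_scale_at_top])

lemma eventually_level_argument:
  assumes "0 < c" "\<And>R. 1 \<le> R \<Longrightarrow> P R"
  shows "\<forall>\<^sub>F r in at_top. P ((exp ^^ p) (c * iter_log_scale r))"
proof -
  have "\<forall>\<^sub>F r in at_top. 1 \<le> (exp ^^ p) (c * iter_log_scale r)"
    using filterlim_compose[OF filterlim_funpow_exp_scale[OF assms(1), of p] iter_log_scale_at_top]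
    unfolding filterlim_at_top by blast
  then show ?thesis by eventually_elim (rule assms(2))
qed

lemma le_level_combination:
  assumes f: "filterlim (nevanlinna_char f) at_top at_top"
    and ga: "nonconst_entire ga" and gb: "nonconst_entire gb" and G: "nonconst_entire G"
    and sum: "\<And>r. 1 \<le> r \<Longrightarrow> nevanlinna_char ga r \<le> nevanlinna_char G r + nevanlinna_char gb r + ln 2"
    and \<rho>: "0 < \<rho>" "rel_order p q \<phi> ga f = ereal \<rho>" "ereal \<rho> < rel_lower_order p q \<phi> gb f"
    and c: "\<rho> < c"
  obtains K where "0 \<le> K" "\<forall>\<^sub>F r in at_top. nevanlinna_char f r \<le> K * level G c r"
proof -
  obtain d where d: "ereal \<rho> < ereal d" "ereal d < rel_lower_order p q \<phi> gb f"
    using ereal_dense2[OF \<rho>(3)] by blast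
  \<comment> \<open>Above \<rho>, so that \<open>level ga c1\<close> bounds T f; below d, so that
    \<open>level gb c1\<close> is a fraction of \<open>level gb d\<close>, which T f exceeds; at
    most c, so that \<open>level G c1\<close> may be replaced by \<open>level G c\<close>.\<close>
  define c1 where "c1 = (\<rho> + min c d) / 2"
  have c1: "\<rho> < c1" "c1 < d" "c1 \<le> c" "0 < c1" using c d \<rho>(1) by (auto simp: c1_def min_def)
  obtain \<kappa> where \<kappa>: "0 \<le> \<kappa>" "\<kappa> < 1" "\<forall>\<^sub>F r in at_top. level gb c1 r \<le> \<kappa> * level gb d r"
    using level_contract[OF gb c1(4,2)] by blast
  \<comment> \<open>The 2 comes from bounding ln 2 by \<open>level G c1\<close>, which is eventually
    at least 1; the denominator from moving \<open>\<kappa> * T f\<close> to the left.\<close>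
  define K where "K = 2 / (1 - \<kappa>)"
  have "\<forall>\<^sub>F r in at_top. 1 \<le> level G c1 r"
    using level_at_top[OF G c1(4)] by (auto simp: filterlim_at_top)
  moreover have "\<forall>\<^sub>F r in at_top. nevanlinna_char f r \<le> level ga c1 r"
    by (rule eventually_le_level[OF f ga]) (use \<rho>(2) c1 in auto)
  moreover have "\<forall>\<^sub>F r in at_top. level gb d r < nevanlinna_char f r"
    by (rule eventually_level_less[OF f gb d(2)])
  moreover have "\<forall>\<^sub>F r in at_top. level ga c1 r \<le> level G c1 r + level gb c1 r + ln 2"
    by (rule eventually_level_argument[OF c1(4) sum])
  ultimately have "\<forall>\<^sub>F r in at_top. nevanlinna_char f r \<le> K * level G c r"
    using \<kappa>(3) level_mono[OF G c1(3)]
  proof eventually_elim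
    case (elim r)
    have "\<kappa> * level gb d r \<le> \<kappa> * nevanlinna_char f r" using elim \<kappa> by (intro mult_left_mono) auto
    moreover have "ln 2 \<le> (1::real)" using ln_le_minus_one[of 2] by simp
    ultimately have "(1 - \<kappa>) * nevanlinna_char f r \<le> 2 * level G c r"
      using elim by (simp add: algebra_simps)
    then show ?case using \<kappa>(2) by (simp add: K_def field_simps)
  qed
  then show ?thesis using \<kappa> by (intro that[of K]) (auto simp: K_def)
qed

lemma rel_order_le:
  assumes F: "filterlim (nevanlinna_char F) at_top at_top" and A: "property_A G"
    and \<mu>: "0 < \<mu>" and K: "\<And>c. \<mu> < c \<Longrightarrow> \<exists>K. \<forall>\<^sub>F r in at_top. nevanlinna_char F r \<le> K * level G c r"
  shows "rel_order p q \<phi> G F \<le> ereal \<mu>"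
proof (rule dense_ge)
  fix x assume x: "ereal \<mu> < x"
  have G: "nonconst_entire G" using A by (simp add: property_A_def)
  obtain c where c: "\<mu> < c" "ereal c < x" using ereal_dense2[OF x] by auto
  \<comment> \<open>The gap between c1 and c is what Property (A) spends to remove K.\<close>
  define c1 where "c1 = (\<mu> + c) / 2"
  have c1: "\<mu> < c1" "c1 < c" "0 < c1" using c \<mu> by (auto simp: c1_def)
  obtain K where "\<forall>\<^sub>F r in at_top. nevanlinna_char F r \<le> K * level G c1 r" using K[OF c1(1)] by blast
  then have "\<forall>\<^sub>F r in at_top. ereal (growth_ratio p q \<phi> G F r) \<le> ereal c"
    using level_property_A[OF A c1(3,2), of K] growth_ratio_le_iff[OF F G]
    by eventually_elim (auto intro: order_trans)
  then have "rel_order p q \<phi> G F \<le> ereal c"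
    unfolding rel_order_def by (rule Limsup_bounded)
  with c show "rel_order p q \<phi> G F \<le> x" by simp
qed

text \<open>Below its order with respect to \<open>ga\<close>, \<open>fj\<close> exceeds the level
  of \<open>ga\<close> for arbitrarily large r, and by \<open>low\<close> it exceeds that of
  \<open>gb\<close> for all large r. So it exceeds a fraction of the level of G, while
  \<open>fi\<close> is too small to cancel it in F.\<close>

lemma rel_order_ge:
  assumes F: "filterlim (nevanlinna_char F) at_top at_top" and A: "property_A G"
    and fi: "filterlim (nevanlinna_char fi) at_top at_top" and fj: "filterlim (nevanlinna_char fj) at_top at_top"
    and ga: "nonconst_entire ga" and gb: "nonconst_entire gb"
    and sumf: "\<And>r. 1 \<le> r \<Longrightarrow> nevanlinna_char fj r \<le> nevanlinna_char F r + nevanlinna_char fi r + ln 2"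
    and sumg: "\<And>r. 1 \<le> r \<Longrightarrow> nevanlinna_char G r \<le> nevanlinna_char ga r + nevanlinna_char gb r + ln 2"
    and less: "rel_order p q \<phi> ga fi < rel_order p q \<phi> ga fj"
    and low: "rel_order p q \<phi> ga fj < rel_lower_order p q \<phi> gb fj"
  shows "rel_order p q \<phi> ga fj \<le> rel_order p q \<phi> G F"
proof (rule dense_le)
  let ?\<mu> = "rel_order p q \<phi> ga fj"
  fix x assume "x < ?\<mu>"
  have G: "nonconst_entire G" using A by (simp add: property_A_def)
  have "max x (rel_order p q \<phi> ga fi) < ?\<mu>" using \<open>x < ?\<mu>\<close> less by simp
  \<comment> \<open>c1 also lies above the order of \<open>fi\<close>, so T fi is at most
    \<open>level ga c1\<close>, a fraction of \<open>level ga c2\<close>.\<close>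
  from ereal_dense2[OF this] obtain c1 where c1: "x < ereal c1" "rel_order p q \<phi> ga fi < ereal c1" "ereal c1 < ?\<mu>" by auto
  have "0 < ereal c1" using rel_order_nonneg[OF fi ga] c1(2) by (rule le_less_trans)
  then have "0 < c1" by simp
  obtain c2 where c2: "c1 < c2" "ereal c2 < ?\<mu>" using ereal_dense2[OF c1(3)] by auto
  have "0 < c2" using c2 \<open>0 < c1\<close> by simp
  obtain \<kappa> where \<kappa>: "0 \<le> \<kappa>" "\<kappa> < 1" "\<forall>\<^sub>F r in at_top. level ga c1 r \<le> \<kappa> * level ga c2 r"
    using level_contract[OF ga \<open>0 < c1\<close> c2(1)] by blast
  \<comment> \<open>T fj is at most \<open>2 / (1 - \<kappa>)\<close> times T F and enters twice,
    through the levels of \<open>ga\<close> and \<open>gb\<close>; the summand 1 pays for ln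
    2.\<close>
  define K where "K = 4 / (1 - \<kappa>) + 1"
  have "K > 0" using \<kappa> by (simp add: K_def add_nonneg_pos)
  have ln2: "ln 2 \<le> (1::real)" using ln_le_minus_one[of 2] by simp
  have "\<forall>\<^sub>F r in at_top. 1 \<le> nevanlinna_char F r"
    using F by (auto simp: filterlim_at_top)
  moreover have "\<forall>\<^sub>F r in at_top. nevanlinna_char fj r \<le> nevanlinna_char F r + nevanlinna_char fi r + ln 2"
    using eventually_ge_at_top[of 1] by eventually_elim (rule sumf)
  moreover have "\<forall>\<^sub>F r in at_top. level G c2 r \<le> level ga c2 r + level gb c2 r + ln 2"
    by (rule eventually_level_argument[OF \<open>0 < c2\<close> sumg])
  moreover have "\<forall>\<^sub>F r in at_top. nevanlinna_char fi r \<le> level ga c1 r"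
    by (rule eventually_le_level[OF fi ga c1(2)])
  moreover have "\<forall>\<^sub>F r in at_top. level gb c2 r < nevanlinna_char fj r"
    by (rule eventually_level_less[OF fj gb]) (use c2 low in auto)
  ultimately have "\<forall>\<^sub>F r in at_top. level ga c2 r < nevanlinna_char fj r \<longrightarrow> c1 < growth_ratio p q \<phi> G F r"
    using \<kappa>(3) level_property_A[OF A \<open>0 < c1\<close> c2(1), of "2 * K"] growth_ratio_le_iff[OF F G]
  proof eventually_elim
    case (elim r)
    show ?case
    proof
      assume *: "level ga c2 r < nevanlinna_char fj r"
      have "\<kappa> * level ga c2 r \<le> \<kappa> * nevanlinna_char fj r" using * \<kappa> by (intro mult_left_mono) auto
      then have "(1 - \<kappa>) * nevanlinna_char fj r \<le> 2 * nevanlinna_char F r"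
        using elim ln2 by (simp add: algebra_simps)
      then have "nevanlinna_char fj r \<le> 2 / (1 - \<kappa>) * nevanlinna_char F r"
        using \<kappa>(2) by (simp add: field_simps)
      moreover have "K * nevanlinna_char F r = 2 * (2 / (1 - \<kappa>) * nevanlinna_char F r) + nevanlinna_char F r"
        by (simp add: K_def algebra_simps)
      ultimately have "level G c2 r \<le> K * nevanlinna_char F r"
        using elim(1,3,5) * ln2 by linarith
      moreover have "K * (2 * level G c1 r) = 2 * K * level G c1 r" by simp
      ultimately have "K * (2 * level G c1 r) \<le> K * nevanlinna_char F r" using elim(7) by linarith
      \<comment> \<open>The factor 2 was carried along to make the next inequality strict, T F being
        positive.\<close>
      then have "2 * level G c1 r \<le> nevanlinna_char F r" using \<open>K > 0\<close> by simp
      then have "\<not> nevanlinna_char F r \<le> level G c1 r" using elim(1) by linarith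
      then show "c1 < growth_ratio p q \<phi> G F r" using elim(8) by (metis not_le)
    qed
  qed
  then have freq: "\<exists>\<^sub>F r in at_top. c1 < growth_ratio p q \<phi> G F r"
    by (rule frequently_mp[OF _ frequently_level_less[OF fj ga c2(2)]])
  have "ereal c1 \<le> rel_order p q \<phi> G F"
  proof (rule ccontr)
    assume "\<not> ?thesis"
    then have "\<forall>\<^sub>F r in at_top. growth_ratio p q \<phi> G F r < c1"
      unfolding rel_order_def using Limsup_lessD by (fastforce simp: not_le)
    then have "\<forall>\<^sub>F r in at_top. \<not> c1 < growth_ratio p q \<phi> G F r" by eventually_elim simp
    then show False using freq by (simp add: frequently_def)
  qed
  with c1(1) show "x \<le> rel_order p q \<phi> G F" by simp
qed

end

lemma filterlim_at_top_of_mono_on: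
  fixes \<phi> :: "real \<Rightarrow> real"
  assumes "mono_on {0..} \<phi>" "\<not> bdd_above (\<phi> ` {0..})"
  shows "filterlim \<phi> at_top at_top"
  unfolding filterlim_at_top
proof
  fix K
  obtain x where x: "x \<ge> 0" "K < \<phi> x"
    using assms(2) by (force simp: bdd_above_def not_le)
  have le: "K \<le> \<phi> y" if "x \<le> y" for y
    using x that monotone_onD[OF assms(1), of x y] by simp
  show "\<forall>\<^sub>F y in at_top. K \<le> \<phi> y"
    by (rule eventually_mono[OF eventually_ge_at_top le])
qed

section \<open>Orders of signed sums of two functions with respect to signed sums\<close>

theorem theorem5:
  fixes p q :: nat
    and \<phi> :: "real \<Rightarrow> real"
    and f g :: "nat \<Rightarrow> complex \<Rightarrow> complex"
    and s t :: complex
  assumes "p \<ge> 1" and "q \<ge> 1"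
    and "\<forall>x\<ge>0. \<phi> x > 0" and "mono_on {0..} \<phi>" and "\<not> bdd_above (\<phi> ` {0..})"
    and "\<forall>i\<in>{1, 2}. f i meromorphic_on UNIV"
    and "\<forall>i\<in>{1, 2}. nonconst_entire (g i)"
    and "s \<in> {1, -1}" and "t \<in> {1, -1}"
    and "property_A (\<lambda>z. g 1 z + t * g 2 z)"
    and "\<forall>i\<in>{1, 2}. \<forall>k\<in>{1, 2}. nonzero_finite (rel_order p q \<phi> (g i) (f k))"
    and "nonzero_finite (rel_order p q \<phi> (\<lambda>z. g 1 z + t * g 2 z) (\<lambda>z. f 1 z + s * f 2 z))"
    and "\<exists>i\<in>{1, 2}. \<exists>j\<in>{1, 2}. i \<noteq> j \<and>
           rel_order p q \<phi> (g i) (f 1) < rel_order p q \<phi> (g j) (f 1) \<and>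
           regular_rel_growth p q \<phi> (g j) (f 1)"
    and "\<exists>i\<in>{1, 2}. \<exists>j\<in>{1, 2}. i \<noteq> j \<and>
           rel_order p q \<phi> (g i) (f 2) < rel_order p q \<phi> (g j) (f 2) \<and>
           regular_rel_growth p q \<phi> (g j) (f 2)"
  shows "rel_order p q \<phi> (\<lambda>z. g 1 z + t * g 2 z) (\<lambda>z. f 1 z + s * f 2 z)
           \<le> max (min (rel_order p q \<phi> (g 1) (f 1)) (rel_order p q \<phi> (g 2) (f 1)))
                 (min (rel_order p q \<phi> (g 1) (f 2)) (rel_order p q \<phi> (g 2) (f 2))) \<and>
         ((\<exists>i\<in>{1, 2}. \<exists>j\<in>{1, 2}. i \<noteq> j \<and>
             rel_order p q \<phi> (g 1) (f i) < rel_order p q \<phi> (g 1) (f j) \<and>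
             rel_order p q \<phi> (g 2) (f i) < rel_order p q \<phi> (g 2) (f j)) \<longrightarrow>
          rel_order p q \<phi> (\<lambda>z. g 1 z + t * g 2 z) (\<lambda>z. f 1 z + s * f 2 z)
           = max (min (rel_order p q \<phi> (g 1) (f 1)) (rel_order p q \<phi> (g 2) (f 1)))
                 (min (rel_order p q \<phi> (g 1) (f 2)) (rel_order p q \<phi> (g 2) (f 2))))"
proof -
  let ?\<rho> = "\<lambda>i k. rel_order p q \<phi> (g i) (f k)"
  let ?G = "\<lambda>z. g 1 z + t * g 2 z" and ?F = "\<lambda>z. f 1 z + s * f 2 z"
  let ?m = "\<lambda>k. min (?\<rho> 1 k) (?\<rho> 2 k)"
  note p = assms(1) and A = assms(10)
  have \<phi>: "filterlim \<phi> at_top at_top"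
    by (rule filterlim_at_top_of_mono_on[OF assms(4,5)])
  have f: "f k meromorphic_on UNIV" and g: "nonconst_entire (g k)" if "k \<in> {1, 2}" for k
    using assms(6,7) that by auto
  have F: "?F meromorphic_on UNIV" by (intro meromorphic_intros f) auto
  have G: "nonconst_entire ?G" using A by (simp add: property_A_def)
  have gm: "g k meromorphic_on UNIV" if "k \<in> {1, 2}" for k
    using g[OF that] by (auto simp: nonconst_entire_def analytic_on_open intro!: analytic_on_imp_meromorphic_on)
  have nf: "nonzero_finite (?\<rho> i k)" if "i \<in> {1, 2}" "k \<in> {1, 2}" for i k
    using assms(11) that by blast
  note f_top = nevanlinna_char_at_top_of_rel_order[OF p \<phi> f nf]
  note F_top = nevanlinna_char_at_top_of_rel_order[OF p \<phi> F assms(12)]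
  note F_sum = nevanlinna_char_signed_sum[OF f[OF insertI1] f[OF insertI2[OF singletonI]] assms(8)]
  note G_sum = nevanlinna_char_signed_sum[OF gm[OF insertI1] gm[OF insertI2[OF singletonI]] assms(9)]
  \<comment> \<open>Here a is the index that attains the minimum and b the other one; regular growth
    with respect to \<open>g b\<close> turns the gap between two orders into a gap between an order
    and a lower order.\<close>
  have split: "\<exists>a b. {a, b} = {1, 2} \<and> ?m k = ?\<rho> a k \<and> ?\<rho> a k < rel_lower_order p q \<phi> (g b) (f k)"
    if k: "k \<in> {1, 2}" for k
  proof -
    have "\<exists>i\<in>{1, 2}. \<exists>j\<in>{1, 2}. i \<noteq> j \<and> ?\<rho> i k < ?\<rho> j k \<and> regular_rel_growth p q \<phi> (g j) (f k)"
      using k assms(13,14) by (elim insertE) simp_all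
    then obtain i j where "i \<in> {1, 2}" "j \<in> {1, 2}" "i \<noteq> j" and less: "?\<rho> i k < ?\<rho> j k"
      and reg: "regular_rel_growth p q \<phi> (g j) (f k)" by blast
    then have ij: "i = 1 \<and> j = 2 \<or> i = 2 \<and> j = 1" by auto
    with less have "?m k = ?\<rho> i k" by (auto simp: min_def)
    moreover have "?\<rho> i k < rel_lower_order p q \<phi> (g j) (f k)"
      using less reg by (simp add: regular_rel_growth_def)
    moreover have "{i, j} = {1, 2}" using ij by auto
    ultimately show ?thesis by blast
  qed
  have bound: "\<exists>\<mu>>0. ?m k = ereal \<mu> \<and> (\<forall>c>\<mu>. \<exists>K\<ge>0. \<forall>\<^sub>F r in at_top.
      nevanlinna_char (f k) r \<le> K * nevanlinna_char ?G ((exp ^^ p) (c * iter_log_scale q \<phi> r)))"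
    if k: "k \<in> {1, 2}" for k
  proof -
    from split[OF k] obtain a b where ab: "{a, b} = {1, 2}" and m: "?m k = ?\<rho> a k"
      and low: "?\<rho> a k < rel_lower_order p q \<phi> (g b) (f k)" by blast
    have a: "a \<in> {1, 2}" and b: "b \<in> {1, 2}" using ab by blast+
    obtain \<mu> where \<mu>: "0 < \<mu>" "?\<rho> a k = ereal \<mu>"
      using rel_order_pos_real[OF p \<phi> f[OF k] g[OF a] nf[OF a k]] by blast
    have sum: "nevanlinna_char (g a) r \<le> nevanlinna_char ?G r + nevanlinna_char (g b) r + ln 2" if "1 \<le> r" for r
      using ab G_sum(2,3)[OF that] by (auto simp: doubleton_eq_iff)
    have "\<exists>K\<ge>0. \<forall>\<^sub>F r in at_top.
        nevanlinna_char (f k) r \<le> K * nevanlinna_char ?G ((exp ^^ p) (c * iter_log_scale q \<phi> r))" if "\<mu> < c" for c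
      using le_level_combination[OF p \<phi> f_top[OF k a k] g[OF a] g[OF b] G sum \<mu> low[unfolded \<mu>(2)] that] by blast
    with \<mu> m show ?thesis by auto
  qed
  obtain \<mu>1 where \<mu>1: "\<mu>1 > 0" "?m 1 = ereal \<mu>1"
    "\<And>c. \<mu>1 < c \<Longrightarrow> \<exists>K\<ge>0. \<forall>\<^sub>F r in at_top.
      nevanlinna_char (f 1) r \<le> K * nevanlinna_char ?G ((exp ^^ p) (c * iter_log_scale q \<phi> r))"
    using bound[of 1] by auto
  obtain \<mu>2 where \<mu>2: "\<mu>2 > 0" "?m 2 = ereal \<mu>2"
    "\<And>c. \<mu>2 < c \<Longrightarrow> \<exists>K\<ge>0. \<forall>\<^sub>F r in at_top.
      nevanlinna_char (f 2) r \<le> K * nevanlinna_char ?G ((exp ^^ p) (c * iter_log_scale q \<phi> r))"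
    using bound[of 2] by auto
  have upper: "rel_order p q \<phi> ?G ?F \<le> ereal (max \<mu>1 \<mu>2)"
  proof (rule rel_order_le[OF p \<phi> F_top A])
    fix c assume c: "max \<mu>1 \<mu>2 < c"
    let ?L = "\<lambda>r. nevanlinna_char ?G ((exp ^^ p) (c * iter_log_scale q \<phi> r))"
    obtain K1 where K1: "\<forall>\<^sub>F r in at_top. nevanlinna_char (f 1) r \<le> K1 * ?L r"
      using \<mu>1(3)[of c] c by auto
    obtain K2 where K2: "\<forall>\<^sub>F r in at_top. nevanlinna_char (f 2) r \<le> K2 * ?L r"
      using \<mu>2(3)[of c] c by auto
    have "\<forall>\<^sub>F r in at_top. 1 \<le> ?L r"
      using level_at_top[OF p \<phi> G, of c] \<mu>1(1) c by (simp add: filterlim_at_top)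
    \<comment> \<open>The summand 1 in the constant pays for ln 2, as \<open>?L r\<close> is
      eventually at least 1.\<close>
    then have "\<forall>\<^sub>F r in at_top. nevanlinna_char ?F r \<le> (K1 + K2 + 1) * ?L r"
      using K1 K2 eventually_ge_at_top[of 1]
    proof eventually_elim
      case (elim r)
      have "nevanlinna_char ?F r \<le> K1 * ?L r + K2 * ?L r + ?L r"
        using F_sum(1)[OF elim(4)] elim(1-3) ln_2_less_1 by linarith
      then show ?case by (simp add: distrib_right)
    qed
    then show "\<exists>K. \<forall>\<^sub>F r in at_top. nevanlinna_char ?F r \<le> K * ?L r" by blast
  qed (use \<mu>1 in auto)
  have max_m: "max (?m 1) (?m 2) = ereal (max \<mu>1 \<mu>2)"
    unfolding \<mu>1(2) \<mu>2(2) by (simp add: max_def)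
  have lower: "max (?m 1) (?m 2) \<le> rel_order p q \<phi> ?G ?F"
    if i: "i \<in> {1, 2}" and j: "j \<in> {1, 2}" and "i \<noteq> j" and less: "?\<rho> 1 i < ?\<rho> 1 j" "?\<rho> 2 i < ?\<rho> 2 j" for i j
  proof -
    from split[OF j] obtain a b where ab: "{a, b} = {1, 2}" and m: "?m j = ?\<rho> a j"
      and low: "?\<rho> a j < rel_lower_order p q \<phi> (g b) (f j)" by blast
    have a: "a \<in> {1, 2}" and b: "b \<in> {1, 2}" using ab by blast+
    have ij: "i = 1 \<and> j = 2 \<or> i = 2 \<and> j = 1" using i j \<open>i \<noteq> j\<close> by auto
    have "?m i \<le> ?m j" using less by (intro min.mono) auto
    then have "max (?m 1) (?m 2) = ?m j"
      using ij by (elim disjE conjE) (simp_all only: max_absorb1 max_absorb2)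
    also have "\<dots> = ?\<rho> a j" by (rule m)
    also have "\<dots> \<le> rel_order p q \<phi> ?G ?F"
    proof (rule rel_order_ge[OF p \<phi> F_top A f_top[OF i a i] f_top[OF j a j] g[OF a] g[OF b] _ _ _ low])
      show "nevanlinna_char (f j) r \<le> nevanlinna_char ?F r + nevanlinna_char (f i) r + ln 2" if "1 \<le> r" for r
        using ij F_sum(2,3)[OF that] by auto
      show "nevanlinna_char ?G r \<le> nevanlinna_char (g a) r + nevanlinna_char (g b) r + ln 2" if "1 \<le> r" for r
        using ab G_sum(1)[OF that] by (auto simp: doubleton_eq_iff)
      \<comment> \<open>Which index a is depends on \<open>f j\<close>; the inequality is assumed
        for both indices, so either case is covered.\<close>
      show "?\<rho> a i < ?\<rho> a j" using a less by auto
    qed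
    finally show ?thesis .
  qed
  show ?thesis
  proof (intro conjI impI antisym)
    show "rel_order p q \<phi> ?G ?F \<le> max (?m 1) (?m 2)" using upper unfolding max_m .
    then show "rel_order p q \<phi> ?G ?F \<le> max (?m 1) (?m 2)" .
    assume "\<exists>i\<in>{1, 2}. \<exists>j\<in>{1, 2}. i \<noteq> j \<and> ?\<rho> 1 i < ?\<rho> 1 j \<and> ?\<rho> 2 i < ?\<rho> 2 j"
    then show "max (?m 1) (?m 2) \<le> rel_order p q \<phi> ?G ?F" using lower by blast
  qed
qed

end
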